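(* Let $\{X_i:i\in I\}$ be a family of Banach spaces and $H$ a Hilbert space (all over the same scalar field $\mathbb{R}$ or $\mathbb{C}$) such that the pair $(X_i,H)$ has the Bishop-Phelps-Bollobás property for operators (BPBp) for every $i\in I$, with the same function $\eta$. Then the pair $\big(\big(\oplus\sum_{i\in I}X_i\big)_{\ell_1},H\big)$ has the BPBp.
   Context: For a normed space $X$, $S_X$ denotes its unit sphere. $\mathcal{L}(X,Y)$ is the space of bounded linear operators from $X$ to $Y$ with the operator norm. A pair $(X,Y)$ of Banach spaces has the BPBp (with the function $\eta$) if for every $\varepsilon>0$ there exists $\eta(\varepsilon)>0$ such that for any $T\in S_{\mathcal{L}(X,Y)}$ and any $x\in S_X$ with $\|Tx\|>1-\eta(\varepsilon)$, there exist $u\in S_X$ and $S\in S_{\mathcal{L}(X,Y)}$ with $\|Su\|=1$, $\|u-x\|<\varepsilon$ and $\|S-T\|<\varepsilon$. $\big(\oplus\sum_{i\in I}X_i\big)_{\ell_1}$ is the Banach space of all families $(x_i)_{i\in I}$ with $x_i\in X_i$ and $\sum_{i\in I}\|x_i\|<\infty$, with norm $\|(x_i)\|=\sum_{i\in I}\|x_i\|$. *)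

theory Defs
  imports "HOL-Analysis.Analysis" "HOL-Algebra.Module"
begin

text \<open>
  The members of a family \<open>X\<^sub>i\<close> are unrelated spaces, so normed spaces are carrier-based: modules
  in the sense of HOL-Algebra, extended by a norm. The inherited ring operations
  \<^const>\<open>mult\<close> and \<^const>\<open>one\<close> of a \<^type>\<open>module_ext\<close> record play no role for modules.

  The scalars are a subset \<open>K\<close> of the complex numbers, where \<open>K = \<real>\<close> is the real case and
  \<open>K = UNIV\<close> the complex case. In the real case the values of \<^const>\<open>smult\<close> at non-real
  arguments are irrelevant.
\<close>

record 'a nspace = "(complex, 'a) module" +
  vnorm :: "'a \<Rightarrow> real"

definition scalars :: "complex set \<Rightarrow> complex ring" where
  "scalars K = \<lparr>carrier = K, mult = (*), one = 1, zero = 0, add = (+)\<rparr>"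

definition normed_space :: "complex set \<Rightarrow> 'a nspace \<Rightarrow> bool" where
  "normed_space K X \<longleftrightarrow>
     module (scalars K) X \<and>
     (\<forall>x\<in>carrier X. 0 \<le> vnorm X x) \<and>
     (\<forall>x\<in>carrier X. vnorm X x = 0 \<longleftrightarrow> x = \<zero>\<^bsub>X\<^esub>) \<and>
     (\<forall>c\<in>K. \<forall>x\<in>carrier X. vnorm X (c \<odot>\<^bsub>X\<^esub> x) = cmod c * vnorm X x) \<and>
     (\<forall>x\<in>carrier X. \<forall>y\<in>carrier X. vnorm X (x \<oplus>\<^bsub>X\<^esub> y) \<le> vnorm X x + vnorm X y)"

definition banach_space :: "complex set \<Rightarrow> 'a nspace \<Rightarrow> bool" where
  "banach_space K X \<longleftrightarrow>
     normed_space K X \<and>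
     (\<forall>\<sigma>. (\<forall>n::nat. \<sigma> n \<in> carrier X) \<and>
          (\<forall>e>0. \<exists>N. \<forall>m\<ge>N. \<forall>n\<ge>N. vnorm X (\<sigma> m \<ominus>\<^bsub>X\<^esub> \<sigma> n) < e) \<longrightarrow>
          (\<exists>l\<in>carrier X. (\<lambda>n. vnorm X (\<sigma> n \<ominus>\<^bsub>X\<^esub> l)) \<longlonglongrightarrow> 0))"

definition inner_product_on :: "complex set \<Rightarrow> 'a nspace \<Rightarrow> ('a \<Rightarrow> 'a \<Rightarrow> complex) \<Rightarrow> bool" where
  "inner_product_on K H ip \<longleftrightarrow>
     (\<forall>x\<in>carrier H. \<forall>y\<in>carrier H. ip x y \<in> K) \<and>
     (\<forall>x\<in>carrier H. \<forall>y\<in>carrier H. \<forall>z\<in>carrier H. ip (x \<oplus>\<^bsub>H\<^esub> y) z = ip x z + ip y z) \<and>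
     (\<forall>c\<in>K. \<forall>x\<in>carrier H. \<forall>y\<in>carrier H. ip (c \<odot>\<^bsub>H\<^esub> x) y = c * ip x y) \<and>
     (\<forall>x\<in>carrier H. \<forall>y\<in>carrier H. ip y x = cnj (ip x y)) \<and>
     (\<forall>x\<in>carrier H. x \<noteq> \<zero>\<^bsub>H\<^esub> \<longrightarrow> 0 < Re (ip x x))"

definition hilbert_space :: "complex set \<Rightarrow> 'a nspace \<Rightarrow> bool" where
  "hilbert_space K H \<longleftrightarrow>
     banach_space K H \<and>
     (\<exists>ip. inner_product_on K H ip \<and> (\<forall>x\<in>carrier H. vnorm H x = sqrt (Re (ip x x))))"

definition unit_sphere :: "'a nspace \<Rightarrow> 'a set" where
  "unit_sphere X = {x \<in> carrier X. vnorm X x = 1}"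

text \<open>Only the values of an operator on the carrier of its domain matter.\<close>

definition bounded_operators :: "complex set \<Rightarrow> 'a nspace \<Rightarrow> 'b nspace \<Rightarrow> ('a \<Rightarrow> 'b) set" where
  "bounded_operators K X Y =
     {T. T \<in> carrier X \<rightarrow> carrier Y \<and>
         (\<forall>x\<in>carrier X. \<forall>y\<in>carrier X. T (x \<oplus>\<^bsub>X\<^esub> y) = T x \<oplus>\<^bsub>Y\<^esub> T y) \<and>
         (\<forall>c\<in>K. \<forall>x\<in>carrier X. T (c \<odot>\<^bsub>X\<^esub> x) = c \<odot>\<^bsub>Y\<^esub> T x) \<and>
         (\<exists>C. \<forall>x\<in>carrier X. vnorm Y (T x) \<le> C * vnorm X x)}"

text \<open>The supremum is over the closed unit ball, so it is also meaningful when \<open>X\<close> is trivial.\<close>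

definition op_norm :: "'a nspace \<Rightarrow> 'b nspace \<Rightarrow> ('a \<Rightarrow> 'b) \<Rightarrow> real" where
  "op_norm X Y T = (SUP x\<in>{x \<in> carrier X. vnorm X x \<le> 1}. vnorm Y (T x))"

definition op_sphere :: "complex set \<Rightarrow> 'a nspace \<Rightarrow> 'b nspace \<Rightarrow> ('a \<Rightarrow> 'b) set" where
  "op_sphere K X Y = {T \<in> bounded_operators K X Y. op_norm X Y T = 1}"

definition BPBp_with :: "(real \<Rightarrow> real) \<Rightarrow> complex set \<Rightarrow> 'a nspace \<Rightarrow> 'b nspace \<Rightarrow> bool" where
  "BPBp_with \<eta> K X Y \<longleftrightarrow>
     (\<forall>\<epsilon>>0. \<eta> \<epsilon> > 0 \<and>
        (\<forall>T\<in>op_sphere K X Y. \<forall>x\<in>unit_sphere X. vnorm Y (T x) > 1 - \<eta> \<epsilon> \<longrightarrow>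
           (\<exists>u\<in>unit_sphere X. \<exists>S\<in>op_sphere K X Y.
              vnorm Y (S u) = 1 \<and> vnorm X (u \<ominus>\<^bsub>X\<^esub> x) < \<epsilon> \<and>
              op_norm X Y (\<lambda>z. S z \<ominus>\<^bsub>Y\<^esub> T z) < \<epsilon>)))"

definition BPBp :: "complex set \<Rightarrow> 'a nspace \<Rightarrow> 'b nspace \<Rightarrow> bool" where
  "BPBp K X Y \<longleftrightarrow> (\<exists>\<eta>. BPBp_with \<eta> K X Y)"

text \<open>
  Families indexed by \<open>I\<close> are extensional functions, so that two families agreeing on \<open>I\<close> are equal.
  The index set may be empty or uncountable.
\<close>

definition l1_sum :: "'i set \<Rightarrow> ('i \<Rightarrow> 'a nspace) \<Rightarrow> ('i \<Rightarrow> 'a) nspace" where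
  "l1_sum I X =
     \<lparr>carrier = {x \<in> (\<Pi>\<^sub>E i\<in>I. carrier (X i)). (\<lambda>i. vnorm (X i) (x i)) summable_on I},
      mult = undefined, one = undefined,
      zero = (\<lambda>i\<in>I. \<zero>\<^bsub>X i\<^esub>),
      add = (\<lambda>x y. \<lambda>i\<in>I. x i \<oplus>\<^bsub>X i\<^esub> y i),
      smult = (\<lambda>c x. \<lambda>i\<in>I. c \<odot>\<^bsub>X i\<^esub> x i),
      vnorm = (\<lambda>x. \<Sum>\<^sub>\<infinity>i\<in>I. vnorm (X i) (x i))\<rparr>"

end

theory Submission
  imports Defs
begin

text \<open>
  Let \<open>h\<close> be the normalization of \<open>T x\<close>. If \<open>\<parallel>T x\<parallel>\<close> is close to \<open>1\<close>, then, up to a set of small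
  \<open>\<ell>\<^sub>1\<close>-mass, \<open>T\<^sub>i\<close> maps \<open>x\<^sub>i / \<parallel>x\<^sub>i\<parallel>\<close> close to \<open>h\<close> for \<open>i\<close> in a finite set \<open>F\<close>. The BPBp of the
  pairs \<open>(X\<^sub>i, H)\<close> replaces each such \<open>T\<^sub>i\<close> by a nearby operator attaining its norm near
  \<open>x\<^sub>i / \<parallel>x\<^sub>i\<parallel>\<close>, and because \<open>H\<close> is a Hilbert space, composing with a contraction of \<open>H\<close> close to
  the identity makes all the attained values equal to the same vector \<open>h\<close>. Gluing these operators
  over \<open>F\<close> with \<open>T\<close> outside \<open>F\<close> gives a contraction of the \<open>\<ell>\<^sub>1\<close>-sum that attains its norm at the
  corresponding combination of unit vectors, since no cancellation occurs. Only finitely many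
  coordinates are changed, so no infinite sums in \<open>H\<close> are needed.
\<close>

section \<open>Normed spaces and contractions\<close>

lemma scalars_simps [simp]:
  "carrier (scalars K) = K" "add (scalars K) = (+)" "mult (scalars K) = (*)"
  "one (scalars K) = 1" "zero (scalars K) = 0"
  by (simp_all add: scalars_def)

text \<open>The real and the complex case are treated together: beyond the ring structure of
  \<open>scalars K\<close>, only \<open>real_K\<close> is asked of the scalars.\<close>

locale nspace =
  fixes K :: "complex set" and X :: "'a nspace" (structure)
  assumes ns: "normed_space K X" and real_K: "\<real> \<subseteq> K"
begin

sublocale module "scalars K" X
  using ns by (simp add: normed_space_def)

lemma of_real_K [simp]: "complex_of_real r \<in> K"
  using real_K by auto

lemma one_K [simp]: "1 \<in> K"
  using of_real_K[of 1] by simp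

lemma minus_one_K [simp]: "- 1 \<in> K"
  using of_real_K[of "-1"] by simp

lemma K_closed [simp]:
  assumes "c \<in> K"
  shows "- c \<in> K" and "d \<in> K \<Longrightarrow> c + d \<in> K" and "d \<in> K \<Longrightarrow> c * d \<in> K" and "d \<in> K \<Longrightarrow> c - d \<in> K"
proof -
  have m: "c * d \<in> K" if "c \<in> K" "d \<in> K" for c d
    using R.m_closed[of c d] that by simp
  have a: "c + d \<in> K" if "c \<in> K" "d \<in> K" for c d
    using R.a_closed[of c d] that by simp
  \<comment> \<open>\<open>a_inv\<close> of the ring record is a definite description, so negatives
    come from multiplication by \<open>- 1\<close>.\<close>
  have n: "- c \<in> K" if "c \<in> K" for c
    using m[OF minus_one_K that] by simp
  show "- c \<in> K" and "d \<in> K \<Longrightarrow> c + d \<in> K" and "d \<in> K \<Longrightarrow> c * d \<in> K" and "d \<in> K \<Longrightarrow> c - d \<in> K"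
    using assms m a n a[of c "- d"] by auto
qed

lemma smult_closed' [simp, intro]: "c \<in> K \<Longrightarrow> x \<in> carrier X \<Longrightarrow> c \<odot> x \<in> carrier X"
  using smult_closed[of c x] by simp

lemma smult_add: "c \<in> K \<Longrightarrow> d \<in> K \<Longrightarrow> x \<in> carrier X \<Longrightarrow> (c + d) \<odot> x = c \<odot> x \<oplus> d \<odot> x"
  using smult_l_distr[of c d x] by simp

lemma smult_distr: "c \<in> K \<Longrightarrow> x \<in> carrier X \<Longrightarrow> y \<in> carrier X \<Longrightarrow> c \<odot> (x \<oplus> y) = c \<odot> x \<oplus> c \<odot> y"
  using smult_r_distr[of c x y] by simp

lemma smult_smult: "c \<in> K \<Longrightarrow> d \<in> K \<Longrightarrow> x \<in> carrier X \<Longrightarrow> c \<odot> (d \<odot> x) = (c * d) \<odot> x"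
  using smult_assoc1[of c d x] by simp

lemma smult_1 [simp]: "x \<in> carrier X \<Longrightarrow> 1 \<odot> x = x"
  using smult_one[of x] by simp

lemma smult_0_left [simp]: "x \<in> carrier X \<Longrightarrow> 0 \<odot> x = \<zero>"
  using smult_l_null[of x] by simp

lemma smult_0_right [simp]: "c \<in> K \<Longrightarrow> c \<odot> \<zero> = \<zero>"
  using smult_r_null[of c] by simp

text \<open>Turns subtraction into scaling by \<open>- 1\<close>, so that identities between
  differences follow from the linearity rules.\<close>

lemma a_inv_smult: "x \<in> carrier X \<Longrightarrow> \<ominus> x = (- 1) \<odot> x"
proof -
  assume x: "x \<in> carrier X"
  have "(- 1) \<odot> x \<oplus> x = ((- 1) + 1) \<odot> x"
    using x smult_add[of "-1" 1 x] by simp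
  also have "\<dots> = \<zero>"
    using x by simp
  finally show ?thesis
    using x minus_equality by simp
qed

lemma minus_smult: "x \<in> carrier X \<Longrightarrow> y \<in> carrier X \<Longrightarrow> x \<ominus> y = x \<oplus> (- 1) \<odot> y"
  by (simp add: minus_eq a_inv_smult)

lemma smult_minus_distr:
  "c \<in> K \<Longrightarrow> x \<in> carrier X \<Longrightarrow> y \<in> carrier X \<Longrightarrow> c \<odot> (x \<ominus> y) = c \<odot> x \<ominus> c \<odot> y"
  by (simp add: minus_smult smult_distr smult_smult)

lemma smult_diff:
  "c \<in> K \<Longrightarrow> d \<in> K \<Longrightarrow> x \<in> carrier X \<Longrightarrow> (c - d) \<odot> x = c \<odot> x \<ominus> d \<odot> x"
  using smult_add[of c "- d" x] by (simp add: minus_smult smult_smult)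

lemma norm_nonneg [simp]: "x \<in> carrier X \<Longrightarrow> 0 \<le> vnorm X x"
  using ns by (simp add: normed_space_def)

lemma norm_eq_0 [simp]: "x \<in> carrier X \<Longrightarrow> vnorm X x = 0 \<longleftrightarrow> x = \<zero>"
  using ns by (simp add: normed_space_def)

lemma norm_zero [simp]: "vnorm X \<zero> = 0"
  by simp

lemma norm_smult [simp]: "c \<in> K \<Longrightarrow> x \<in> carrier X \<Longrightarrow> vnorm X (c \<odot> x) = cmod c * vnorm X x"
  using ns by (simp add: normed_space_def)

lemma norm_triangle: "x \<in> carrier X \<Longrightarrow> y \<in> carrier X \<Longrightarrow> vnorm X (x \<oplus> y) \<le> vnorm X x + vnorm X y"
  using ns by (simp add: normed_space_def)

lemma norm_minus_commute:
  assumes "x \<in> carrier X" "y \<in> carrier X"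
  shows "vnorm X (x \<ominus> y) = vnorm X (y \<ominus> x)"
proof -
  have "x \<ominus> y = (- 1) \<odot> (y \<ominus> x)"
    using assms by (simp add: minus_smult smult_distr smult_smult a_comm)
  then show ?thesis
    using assms by simp
qed

lemma minus_add_minus:
  assumes "x \<in> carrier X" "y \<in> carrier X" "z \<in> carrier X"
  shows "(x \<ominus> y) \<oplus> (y \<ominus> z) = x \<ominus> z"
  using assms by (simp add: minus_eq a_assoc r_neg1)

lemma dist_triangle:
  assumes "x \<in> carrier X" "y \<in> carrier X" "z \<in> carrier X"
  shows "vnorm X (x \<ominus> z) \<le> vnorm X (x \<ominus> y) + vnorm X (y \<ominus> z)"
  using norm_triangle[of "x \<ominus> y" "y \<ominus> z"] assms by (simp add: minus_add_minus)

lemma add_minus_add: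
  assumes "x \<in> carrier X" "y \<in> carrier X" "z \<in> carrier X" "w \<in> carrier X"
  shows "(x \<oplus> y) \<ominus> (z \<oplus> w) = (x \<ominus> z) \<oplus> (y \<ominus> w)"
  using assms by (simp add: minus_eq minus_add a_ac)

lemma minus_self [simp]: "x \<in> carrier X \<Longrightarrow> x \<ominus> x = \<zero>"
  by (simp add: minus_eq r_neg)

lemma norm_finsum:
  assumes "finite F" "f \<in> F \<rightarrow> carrier X"
  shows "vnorm X (finsum X f F) \<le> (\<Sum>i\<in>F. vnorm X (f i))"
  using assms
proof (induction F)
  case empty
  then show ?case by simp
next
  case (insert j F)
  then have "vnorm X (finsum X f (insert j F)) \<le> vnorm X (f j) + vnorm X (finsum X f F)"
    by (simp add: finsum_insert norm_triangle Pi_def finsum_closed)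
  with insert show ?case by simp
qed

lemma finsum_minus_distrib:
  assumes "finite F" "f \<in> F \<rightarrow> carrier X" "g \<in> F \<rightarrow> carrier X"
  shows "finsum X f F \<ominus> finsum X g F = finsum X (\<lambda>i. f i \<ominus> g i) F"
  using assms
proof (induction F)
  case empty
  then show ?case by simp
next
  case (insert j F)
  then have [simp]: "f \<in> F \<rightarrow> carrier X" "g \<in> F \<rightarrow> carrier X" "f j \<in> carrier X" "g j \<in> carrier X"
      "(\<lambda>i. f i \<ominus> g i) \<in> F \<rightarrow> carrier X"
    by auto
  show ?case
    using insert by (simp add: add_minus_add finsum_closed)
qed

text \<open>Membership in \<open>K\<close> is part of the induction: \<open>smult_add\<close> needs
  the partial sum to be a scalar.\<close>

lemma finsum_smult_left:
  assumes "finite F" "c \<in> F \<rightarrow> K" "x \<in> carrier X"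
  shows "finsum X (\<lambda>i. c i \<odot> x) F = (\<Sum>i\<in>F. c i) \<odot> x \<and> (\<Sum>i\<in>F. c i) \<in> K"
  using assms
proof (induction F)
  case empty
  then show ?case using of_real_K[of 0] by simp
next
  case (insert j F)
  then show ?case
    by (simp add: finsum_insert smult_add Pi_def)
qed

end

section \<open>Bounded operators, contractions and the operator norm\<close>

lemma bounded_operatorsI:
  assumes "\<And>x. x \<in> carrier X \<Longrightarrow> T x \<in> carrier Y"
    and "\<And>x y. x \<in> carrier X \<Longrightarrow> y \<in> carrier X \<Longrightarrow> T (x \<oplus>\<^bsub>X\<^esub> y) = T x \<oplus>\<^bsub>Y\<^esub> T y"
    and "\<And>c x. c \<in> K \<Longrightarrow> x \<in> carrier X \<Longrightarrow> T (c \<odot>\<^bsub>X\<^esub> x) = c \<odot>\<^bsub>Y\<^esub> T x"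
    and "\<And>x. x \<in> carrier X \<Longrightarrow> vnorm Y (T x) \<le> C * vnorm X x"
  shows "T \<in> bounded_operators K X Y"
  using assms unfolding bounded_operators_def by blast

lemma bounded_operatorsD:
  assumes "T \<in> bounded_operators K X Y"
  shows "x \<in> carrier X \<Longrightarrow> T x \<in> carrier Y"
    and "x \<in> carrier X \<Longrightarrow> y \<in> carrier X \<Longrightarrow> T (x \<oplus>\<^bsub>X\<^esub> y) = T x \<oplus>\<^bsub>Y\<^esub> T y"
    and "c \<in> K \<Longrightarrow> x \<in> carrier X \<Longrightarrow> T (c \<odot>\<^bsub>X\<^esub> x) = c \<odot>\<^bsub>Y\<^esub> T x"
  using assms unfolding bounded_operators_def by blast+

text \<open>The closed unit ball of the operator space, described pointwise: in this form it is
  easily seen to be stable under composition and gluing, without any supremum.\<close>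

definition contractions :: "complex set \<Rightarrow> 'a nspace \<Rightarrow> 'b nspace \<Rightarrow> ('a \<Rightarrow> 'b) set" where
  "contractions K X Y =
     {T \<in> bounded_operators K X Y. \<forall>x\<in>carrier X. vnorm Y (T x) \<le> vnorm X x}"

lemma contractionsI:
  assumes "\<And>x. x \<in> carrier X \<Longrightarrow> T x \<in> carrier Y"
    and "\<And>x y. x \<in> carrier X \<Longrightarrow> y \<in> carrier X \<Longrightarrow> T (x \<oplus>\<^bsub>X\<^esub> y) = T x \<oplus>\<^bsub>Y\<^esub> T y"
    and "\<And>c x. c \<in> K \<Longrightarrow> x \<in> carrier X \<Longrightarrow> T (c \<odot>\<^bsub>X\<^esub> x) = c \<odot>\<^bsub>Y\<^esub> T x"
    and "\<And>x. x \<in> carrier X \<Longrightarrow> vnorm Y (T x) \<le> vnorm X x"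
  shows "T \<in> contractions K X Y"
  using bounded_operatorsI[of X T Y K 1] assms unfolding contractions_def by simp

lemma contractionsD:
  assumes "T \<in> contractions K X Y"
  shows "T \<in> bounded_operators K X Y"
    and "x \<in> carrier X \<Longrightarrow> T x \<in> carrier Y"
    and "x \<in> carrier X \<Longrightarrow> y \<in> carrier X \<Longrightarrow> T (x \<oplus>\<^bsub>X\<^esub> y) = T x \<oplus>\<^bsub>Y\<^esub> T y"
    and "c \<in> K \<Longrightarrow> x \<in> carrier X \<Longrightarrow> T (c \<odot>\<^bsub>X\<^esub> x) = c \<odot>\<^bsub>Y\<^esub> T x"
    and "x \<in> carrier X \<Longrightarrow> vnorm Y (T x) \<le> vnorm X x"
  using assms bounded_operatorsD[of T K X Y] unfolding contractions_def by blast+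

lemma contractions_comp:
  assumes "S \<in> contractions K Y Z" "T \<in> contractions K X Y"
  shows "(\<lambda>x. S (T x)) \<in> contractions K X Z"
proof (rule contractionsI)
  fix x assume "x \<in> carrier X"
  then show "vnorm Z (S (T x)) \<le> vnorm X x"
    using contractionsD(5)[OF assms(1), of "T x"] contractionsD(5)[OF assms(2), of x]
      contractionsD(2)[OF assms(2), of x] by simp
qed (use contractionsD[OF assms(1)] contractionsD[OF assms(2)] in auto)

locale nspace_pair = X: nspace K X + Y: nspace K Y
  for K :: "complex set" and X :: "'a nspace" and Y :: "'b nspace"
begin

lemma bounded_operators_minus:
  assumes "T \<in> bounded_operators K X Y" "x \<in> carrier X" "y \<in> carrier X"
  shows "T (x \<ominus>\<^bsub>X\<^esub> y) = T x \<ominus>\<^bsub>Y\<^esub> T y"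
  using assms by (simp add: X.minus_smult Y.minus_smult bounded_operatorsD)

lemma bounded_operators_zero:
  assumes "T \<in> bounded_operators K X Y"
  shows "T \<zero>\<^bsub>X\<^esub> = \<zero>\<^bsub>Y\<^esub>"
  using bounded_operatorsD(3)[OF assms, of 0 "\<zero>\<^bsub>X\<^esub>"] bounded_operatorsD(1)[OF assms, of "\<zero>\<^bsub>X\<^esub>"]
    X.of_real_K[of 0] by simp

lemma op_norm_bdd:
  assumes "T \<in> bounded_operators K X Y"
  shows "bdd_above ((\<lambda>x. vnorm Y (T x)) ` {x \<in> carrier X. vnorm X x \<le> 1})"
proof -
  obtain C where C: "\<And>x. x \<in> carrier X \<Longrightarrow> vnorm Y (T x) \<le> C * vnorm X x"
    using assms unfolding bounded_operators_def by blast
  have "vnorm Y (T x) \<le> \<bar>C\<bar>" if "x \<in> carrier X" "vnorm X x \<le> 1" for x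
  proof -
    \<comment> \<open>\<open>C\<close> carries no sign condition, hence its absolute value.\<close>
    have "C * vnorm X x \<le> \<bar>C\<bar> * vnorm X x"
      using that by (intro mult_right_mono) auto
    also have "\<dots> \<le> \<bar>C\<bar> * 1"
      using that by (intro mult_left_mono) auto
    finally show ?thesis using C[OF that(1)] by simp
  qed
  then show ?thesis by (intro bdd_aboveI2) auto
qed

lemma op_norm_upper:
  assumes "T \<in> bounded_operators K X Y" "x \<in> carrier X" "vnorm X x \<le> 1"
  shows "vnorm Y (T x) \<le> op_norm X Y T"
  unfolding op_norm_def using assms by (intro cSUP_upper op_norm_bdd) auto

lemma op_norm_least:
  assumes "\<And>x. x \<in> carrier X \<Longrightarrow> vnorm X x \<le> 1 \<Longrightarrow> vnorm Y (T x) \<le> C"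
  shows "op_norm X Y T \<le> C"
  unfolding op_norm_def
proof (rule cSUP_least)
  show "{x \<in> carrier X. vnorm X x \<le> 1} \<noteq> {}"
    using X.zero_closed by fastforce
qed (use assms in auto)

lemma le_op_norm:
  assumes T: "T \<in> bounded_operators K X Y" and x: "x \<in> carrier X"
  shows "vnorm Y (T x) \<le> op_norm X Y T * vnorm X x"
proof (cases "x = \<zero>\<^bsub>X\<^esub>")
  case True
  then show ?thesis using bounded_operators_zero[OF T] by simp
next
  case False
  then have pos: "vnorm X x > 0"
    using x X.norm_eq_0[OF x] X.norm_nonneg[OF x] by linarith
  \<comment> \<open>The scalar is kept as \<open>complex_of_real\<close> of a real quotient, because
    \<open>of_real_K\<close> then puts it into \<open>K\<close>; \<open>of_real_divide\<close> would
    destroy this form.\<close>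
  let ?c = "complex_of_real (1 / vnorm X x)"
  have [simp]: "cmod ?c = 1 / vnorm X x"
    using pos by (simp only: norm_of_real) simp
  have "vnorm Y (T (?c \<odot>\<^bsub>X\<^esub> x)) \<le> op_norm X Y T"
    using x pos by (intro op_norm_upper T) (simp_all del: of_real_divide)
  then have "1 / vnorm X x * vnorm Y (T x) \<le> op_norm X Y T"
    using x by (simp add: bounded_operatorsD[OF T] del: of_real_divide)
  then show ?thesis using pos by (simp add: field_simps)
qed

lemma op_sphere_contractions: "T \<in> op_sphere K X Y \<Longrightarrow> T \<in> contractions K X Y"
  using le_op_norm[of T] by (auto simp: op_sphere_def contractions_def)

text \<open>Attaining the value 1 at a unit vector forces the norm to be exactly 1. This places the
  glued operator on the unit sphere.\<close>

lemma contractions_op_sphere: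
  assumes "T \<in> contractions K X Y" "u \<in> unit_sphere X" "vnorm Y (T u) = 1"
  shows "T \<in> op_sphere K X Y"
proof -
  have "op_norm X Y T \<le> 1"
    by (rule op_norm_least) (use contractionsD(5)[OF assms(1)] in fastforce)
  moreover have "1 \<le> op_norm X Y T"
    using op_norm_upper[OF contractionsD(1)[OF assms(1)], of u] assms by (simp add: unit_sphere_def)
  ultimately show ?thesis
    using contractionsD(1)[OF assms(1)] by (simp add: op_sphere_def)
qed

text \<open>Makes \<open>le_op_norm\<close> applicable to differences, so that a bound on their
  \<open>op_norm\<close> becomes a pointwise one.\<close>

lemma bounded_operators_diff:
  assumes S: "S \<in> bounded_operators K X Y" and T: "T \<in> bounded_operators K X Y"
  shows "(\<lambda>z. S z \<ominus>\<^bsub>Y\<^esub> T z) \<in> bounded_operators K X Y"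
proof (rule bounded_operatorsI)
  fix x assume x: "x \<in> carrier X"
  note Sx = bounded_operatorsD(1)[OF S x] and Tx = bounded_operatorsD(1)[OF T x]
  have "vnorm Y (S x \<ominus>\<^bsub>Y\<^esub> T x) \<le> vnorm Y (S x \<ominus>\<^bsub>Y\<^esub> \<zero>\<^bsub>Y\<^esub>) + vnorm Y (T x \<ominus>\<^bsub>Y\<^esub> \<zero>\<^bsub>Y\<^esub>)"
    using Y.dist_triangle[OF Sx Y.zero_closed Tx] Y.norm_minus_commute[OF Y.zero_closed Tx] by simp
  also have "\<dots> = vnorm Y (S x) + vnorm Y (T x)"
    using Sx Tx by (simp add: Y.minus_smult)
  finally show "vnorm Y (S x \<ominus>\<^bsub>Y\<^esub> T x) \<le> (op_norm X Y S + op_norm X Y T) * vnorm X x"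
    using le_op_norm[OF S x] le_op_norm[OF T x] by (simp add: distrib_right)
qed (use S T in \<open>simp_all add: bounded_operatorsD Y.add_minus_add Y.smult_minus_distr\<close>)

end

section \<open>Inner product spaces\<close>

locale inner_product_space = nspace K H for K and H :: "'h nspace" (structure) +
  fixes ip :: "'h \<Rightarrow> 'h \<Rightarrow> complex"
  assumes inner_product: "inner_product_on K H ip"
    and norm_eq_sqrt: "x \<in> carrier H \<Longrightarrow> vnorm H x = sqrt (Re (ip x x))"
begin

lemma ip_K [simp]: "x \<in> carrier H \<Longrightarrow> y \<in> carrier H \<Longrightarrow> ip x y \<in> K"
  using inner_product unfolding inner_product_on_def by blast

lemma ip_cnj: "x \<in> carrier H \<Longrightarrow> y \<in> carrier H \<Longrightarrow> ip y x = cnj (ip x y)"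
  using inner_product unfolding inner_product_on_def by blast

lemma ip_add_left:
  "x \<in> carrier H \<Longrightarrow> y \<in> carrier H \<Longrightarrow> z \<in> carrier H \<Longrightarrow> ip (x \<oplus> y) z = ip x z + ip y z"
  using inner_product unfolding inner_product_on_def by blast

lemma ip_smult_left: "c \<in> K \<Longrightarrow> x \<in> carrier H \<Longrightarrow> y \<in> carrier H \<Longrightarrow> ip (c \<odot> x) y = c * ip x y"
  using inner_product unfolding inner_product_on_def by blast

lemma ip_add_right:
  "x \<in> carrier H \<Longrightarrow> y \<in> carrier H \<Longrightarrow> z \<in> carrier H \<Longrightarrow> ip x (y \<oplus> z) = ip x y + ip x z"
  using ip_cnj[of "y \<oplus> z" x] ip_cnj[of y x] ip_cnj[of z x] by (simp add: ip_add_left)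

lemma ip_smult_right:
  "c \<in> K \<Longrightarrow> x \<in> carrier H \<Longrightarrow> y \<in> carrier H \<Longrightarrow> ip x (c \<odot> y) = cnj c * ip x y"
  using ip_cnj[of "c \<odot> y" x] ip_cnj[of y x] by (simp add: ip_smult_left)

lemmas ip_linear = ip_add_left ip_add_right ip_smult_left ip_smult_right

lemma ip_zero_left [simp]: "x \<in> carrier H \<Longrightarrow> ip \<zero> x = 0"
  using ip_smult_left[of 0 \<zero> x] of_real_K[of 0] by simp

lemma ip_self: "x \<in> carrier H \<Longrightarrow> ip x x = complex_of_real ((vnorm H x)\<^sup>2)"
proof -
  assume x: "x \<in> carrier H"
  \<comment> \<open>The real \<open>sqrt\<close> is negative on negative arguments, so nonnegativity
    of the norm excludes a negative \<open>Re (ip x x)\<close>.\<close>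
  have "Re (ip x x) \<ge> 0"
    using norm_nonneg[OF x] norm_eq_sqrt[OF x] real_sqrt_lt_0_iff[of "Re (ip x x)"] by linarith
  moreover have "Im (ip x x) = 0"
    using arg_cong[OF ip_cnj[OF x x], of Im] by simp
  ultimately show ?thesis
    using norm_eq_sqrt[OF x] by (simp add: complex_eq_iff)
qed

lemma ip_self_unit [simp]: "x \<in> carrier H \<Longrightarrow> vnorm H x = 1 \<Longrightarrow> ip x x = 1"
  by (simp add: ip_self)

text \<open>Pythagoras: for a unit vector \<open>y\<close> the remainder is orthogonal to
  \<open>y\<close>. Cauchy-Schwarz follows because the left side is nonnegative.\<close>

lemma norm_minus_projection:
  assumes x: "x \<in> carrier H" and y: "y \<in> carrier H" and u: "vnorm H y = 1"
  shows "(vnorm H (x \<oplus> (- ip x y) \<odot> y))\<^sup>2 = (vnorm H x)\<^sup>2 - (cmod (ip x y))\<^sup>2"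
proof -
  have "complex_of_real ((vnorm H (x \<oplus> (- ip x y) \<odot> y))\<^sup>2)
      = ip (x \<oplus> (- ip x y) \<odot> y) (x \<oplus> (- ip x y) \<odot> y)"
    using x y by (simp only: ip_self a_closed smult_closed' K_closed ip_K)
  also have "\<dots> = ip x x - ip x y * cnj (ip x y)"
    using x y u by (simp add: ip_linear ip_cnj[OF x y])
  also have "\<dots> = complex_of_real ((vnorm H x)\<^sup>2 - (cmod (ip x y))\<^sup>2)"
    using x by (simp add: ip_self complex_norm_square[symmetric] del: of_real_power)
  finally show ?thesis
    using of_real_eq_iff by blast
qed

lemma cauchy_schwarz_unit:
  assumes "x \<in> carrier H" "y \<in> carrier H" "vnorm H y = 1"
  shows "cmod (ip x y) \<le> vnorm H x"
proof -
  have "(cmod (ip x y))\<^sup>2 \<le> (vnorm H x)\<^sup>2"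
    using norm_minus_projection[OF assms] zero_le_power2[of "vnorm H (x \<oplus> (- ip x y) \<odot> y)"]
    by linarith
  then show ?thesis
    using assms(1) norm_nonneg power2_le_imp_le by blast
qed

lemma cauchy_schwarz:
  assumes x: "x \<in> carrier H" and y: "y \<in> carrier H"
  shows "cmod (ip x y) \<le> vnorm H x * vnorm H y"
proof (cases "y = \<zero>")
  case True
  then show ?thesis using x ip_cnj[of \<zero> x] by simp
next
  case False
  then have pos: "vnorm H y > 0"
    using norm_eq_0[OF y] norm_nonneg[OF y] by linarith
  let ?c = "complex_of_real (1 / vnorm H y)"
  have c: "cmod ?c = 1 / vnorm H y"
    using pos by (simp only: norm_of_real) simp
  have "cmod (ip x (?c \<odot> y)) \<le> vnorm H x"
    using False x y c by (intro cauchy_schwarz_unit) (simp_all del: of_real_divide)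
  then have "1 / vnorm H y * cmod (ip x y) \<le> vnorm H x"
    using x y c by (simp add: ip_smult_right norm_mult del: of_real_divide)
  then show ?thesis
    using pos by (simp add: field_simps)
qed

lemma Re_ip_finsum:
  assumes "finite F" "f \<in> F \<rightarrow> carrier H" "h \<in> carrier H"
  shows "Re (ip (finsum H f F) h) = (\<Sum>i\<in>F. Re (ip (f i) h))"
  using assms
proof (induction F)
  case empty
  then show ?case by simp
next
  case (insert j F)
  then show ?case
    by (simp add: finsum_insert ip_add_left Pi_def finsum_closed)
qed

text \<open>The squared distance is the squared norm of \<open>w\<close> plus 1 minus 2 Re <w, h>,
  hence at most 2 - 2 (1 - d). Thus a nearly maximal inner product forces closeness.\<close>

lemma norm_minus_le_of_Re_ip:
  assumes w: "w \<in> carrier H" "vnorm H w \<le> 1" and h: "h \<in> carrier H" "vnorm H h = 1"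
    and re: "Re (ip w h) > 1 - d"
  shows "vnorm H (w \<ominus> h) \<le> sqrt (2 * d)"
proof -
  have "complex_of_real ((vnorm H (w \<ominus> h))\<^sup>2) = ip (w \<ominus> h) (w \<ominus> h)"
    using w h by (simp only: ip_self minus_closed)
  also have "\<dots> = ip w w + ip h h - (ip w h + cnj (ip w h))"
    using w h by (simp add: minus_smult ip_linear ip_cnj[OF w(1) h(1)])
  finally have "complex_of_real ((vnorm H (w \<ominus> h))\<^sup>2)
      = complex_of_real ((vnorm H w)\<^sup>2 + 1 - 2 * Re (ip w h))"
    using w h by (simp add: ip_self complex_eq_iff)
  then have "(vnorm H (w \<ominus> h))\<^sup>2 = (vnorm H w)\<^sup>2 + 1 - 2 * Re (ip w h)"
    using of_real_eq_iff by blast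
  moreover have "(vnorm H w)\<^sup>2 \<le> 1"
    using w by (simp add: power_le_one)
  ultimately have "(vnorm H (w \<ominus> h))\<^sup>2 \<le> 2 * d"
    using re by linarith
  then show ?thesis
    using real_le_rsqrt by blast
qed

text \<open>
  The operator sends \<open>a\<close> to \<open>b\<close> and projects the orthogonal complement of \<open>a\<close> onto that of \<open>b\<close>.
  Unlike a rotation formula, this needs no case distinction on the scalars or on \<open>b = - a\<close>.
\<close>

lemma contraction_near_identity:
  assumes a: "a \<in> carrier H" "vnorm H a = 1" and b: "b \<in> carrier H" "vnorm H b = 1"
  obtains R where "R \<in> contractions K H H" "R a = b"
    "\<And>y. y \<in> carrier H \<Longrightarrow> vnorm H (R y \<ominus> y) \<le> 2 * vnorm H (b \<ominus> a) * vnorm H y"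
proof -
  \<comment> \<open>With y' = y - <y, a> a, the component of y orthogonal to \<open>a\<close>,
    \<open>\<beta> y\<close> is <y', b>, and \<open>R y\<close> below equals <y, a> b plus the
    component of y' orthogonal to \<open>b\<close>.\<close>
  define \<beta> where "\<beta> y = ip y b - ip y a * ip a b" for y
  define P where "P y = (- ip y a) \<odot> a \<oplus> (ip y a - \<beta> y) \<odot> b" for y
  define R where "R y = y \<oplus> P y" for y
  have \<beta>K [simp]: "\<beta> y \<in> K" if "y \<in> carrier H" for y
    using that a b by (simp add: \<beta>_def)
  have Pc [simp]: "P y \<in> carrier H" if "y \<in> carrier H" for y
    using that a b by (simp add: P_def)
  have \<beta>_add: "\<beta> (x \<oplus> y) = \<beta> x + \<beta> y" if "x \<in> carrier H" "y \<in> carrier H" for x y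
    using that a b by (simp add: \<beta>_def ip_linear algebra_simps)
  have \<beta>_smult: "\<beta> (c \<odot> y) = c * \<beta> y" if "c \<in> K" "y \<in> carrier H" for c y
    using that a b by (simp add: \<beta>_def ip_linear algebra_simps)
  have P_add: "P (x \<oplus> y) = P x \<oplus> P y" if "x \<in> carrier H" "y \<in> carrier H" for x y
  proof -
    have "P (x \<oplus> y) = (- ip x a + - ip y a) \<odot> a \<oplus> ((ip x a - \<beta> x) + (ip y a - \<beta> y)) \<odot> b"
      using that a by (simp add: P_def \<beta>_add ip_linear algebra_simps)
    then show ?thesis
      using that a b by (simp only: smult_add K_closed ip_K \<beta>K P_def) (simp add: a_ac)
  qed
  have P_smult: "P (c \<odot> y) = c \<odot> P y" if "c \<in> K" "y \<in> carrier H" for c y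
    using that a b by (simp add: P_def \<beta>_smult ip_linear smult_distr smult_smult algebra_simps)
  have norm_R: "vnorm H (R y) \<le> vnorm H y" if y: "y \<in> carrier H" for y
  proof -
    have "complex_of_real ((vnorm H (R y))\<^sup>2) = ip (R y) (R y)"
      unfolding R_def using y by (simp only: ip_self a_closed Pc)
    \<comment> \<open>The two components of \<open>R y\<close> are orthogonal, and only the
      projection of y' onto \<open>b\<close> has been lost from y.\<close>
    also have "\<dots> = ip y y - \<beta> y * cnj (\<beta> y)"
      using y a b
      by (simp add: R_def P_def ip_linear ip_cnj[OF y a(1)] ip_cnj[OF y b(1)] ip_cnj[OF a(1) b(1)])
        (simp add: \<beta>_def algebra_simps)
    also have "\<dots> = complex_of_real ((vnorm H y)\<^sup>2 - (cmod (\<beta> y))\<^sup>2)"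
      using y by (simp add: ip_self complex_norm_square[symmetric] del: of_real_power)
    finally have "(vnorm H (R y))\<^sup>2 = (vnorm H y)\<^sup>2 - (cmod (\<beta> y))\<^sup>2"
      using of_real_eq_iff by blast
    then have "(vnorm H (R y))\<^sup>2 \<le> (vnorm H y)\<^sup>2"
      by simp
    then show ?thesis
      using y norm_nonneg power2_le_imp_le by blast
  qed
  show thesis
  proof
    show "R \<in> contractions K H H"
    proof (rule contractionsI)
      fix x y assume "x \<in> carrier H" "y \<in> carrier H"
      then show "R (x \<oplus> y) = R x \<oplus> R y"
        by (simp add: R_def P_add a_ac)
    next
      fix c y assume "c \<in> K" "y \<in> carrier H"
      then show "R (c \<odot> y) = c \<odot> R y"
        by (simp add: R_def P_smult smult_distr)
    qed (simp_all add: norm_R, simp add: R_def)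
    have "\<beta> a = 0"
      using a by (simp add: \<beta>_def ip_self)
    then have "P a = (- 1) \<odot> a \<oplus> b"
      using a b by (simp add: P_def ip_self)
    then show "R a = b"
      using a b by (simp add: R_def a_inv_smult[symmetric] r_neg2 r_neg1)
  next
    fix y assume y: "y \<in> carrier H"
    let ?y' = "y \<oplus> (- ip y a) \<odot> a"
    \<comment> \<open>As y' is orthogonal to \<open>a\<close>, replacing \<open>b\<close> by
      \<open>b \<ominus> a\<close> changes nothing, and Cauchy-Schwarz then gives a factor that is
      small when \<open>b\<close> is near \<open>a\<close>.\<close>
    have \<beta>_eq: "\<beta> y = ip ?y' (b \<ominus> a)"
      using y a b by (simp add: \<beta>_def minus_smult ip_linear algebra_simps)
    have "(vnorm H ?y')\<^sup>2 \<le> (vnorm H y)\<^sup>2"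
      using norm_minus_projection[OF y a] by simp
    then have y': "vnorm H ?y' \<le> vnorm H y"
      using y norm_nonneg power2_le_imp_le by blast
    have \<beta>_le: "cmod (\<beta> y) \<le> vnorm H (b \<ominus> a) * vnorm H y"
    proof -
      have "cmod (\<beta> y) \<le> vnorm H ?y' * vnorm H (b \<ominus> a)"
        unfolding \<beta>_eq using y a b by (intro cauchy_schwarz) auto
      also have "\<dots> \<le> vnorm H y * vnorm H (b \<ominus> a)"
        using y' a b by (intro mult_right_mono) auto
      finally show ?thesis by (simp add: mult.commute)
    qed
    have "R y \<ominus> y = P y"
      using y by (simp add: R_def minus_eq a_comm[of y "P y"] a_assoc r_neg)
    \<comment> \<open>Each of the two terms has norm at most
      \<open>vnorm H (b \<ominus> a) * vnorm H y\<close>, whence the factor 2.\<close>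
    also have "P y = ip y a \<odot> (b \<ominus> a) \<oplus> (- \<beta> y) \<odot> b"
      using y a b smult_add[of "ip y a" "- \<beta> y" b]
      by (simp add: P_def minus_smult smult_distr smult_smult a_ac)
    finally have "vnorm H (R y \<ominus> y) \<le> cmod (ip y a) * vnorm H (b \<ominus> a) + cmod (\<beta> y)"
      using norm_triangle[of "ip y a \<odot> (b \<ominus> a)" "(- \<beta> y) \<odot> b"] y a b by simp
    moreover have "cmod (ip y a) * vnorm H (b \<ominus> a) \<le> vnorm H y * vnorm H (b \<ominus> a)"
      using cauchy_schwarz_unit[OF y a] a b by (intro mult_right_mono) auto
    ultimately show "vnorm H (R y \<ominus> y) \<le> 2 * vnorm H (b \<ominus> a) * vnorm H y"
      using \<beta>_le by (simp add: mult.commute)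
  qed
qed

end

text \<open>Upgrades the BPBp in two ways: \<open>T\<close> need only be a contraction, which is
  handled by normalizing it, and the attained value is the prescribed \<open>h\<close>, arranged by
  a contraction of \<open>H\<close> near the identity. Using one \<open>h\<close> for several
  summands prevents cancellation after gluing.\<close>

lemma BPBp_with_rotated:
  assumes X: "nspace K X" and H: "inner_product_space K H ip" and BPB: "BPBp_with \<eta> K X H"
    and T: "T \<in> contractions K X H" and x: "x \<in> unit_sphere X"
    and h: "h \<in> carrier H" "vnorm H h = 1" and re: "Re (ip (T x) h) > 1 - d"
    and e: "0 < e" and d: "d \<le> \<eta> e" "d \<le> e" "d \<le> e\<^sup>2 / 2" "d \<le> 1 / 2"
  obtains u S where "u \<in> unit_sphere X" "S \<in> contractions K X H" "S u = h"
    "vnorm X (u \<ominus>\<^bsub>X\<^esub> x) < e"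
    "\<And>z. z \<in> carrier X \<Longrightarrow> vnorm H (S z \<ominus>\<^bsub>H\<^esub> T z) \<le> 10 * e * vnorm X z"
proof -
  interpret H: inner_product_space K H ip by (rule H)
  interpret nspace_pair K X H by (intro nspace_pair.intro X H.nspace_axioms)
  define t where "t = op_norm X H T"
  note Tb = contractionsD(1)[OF T]
  have xc [simp]: "x \<in> carrier X" and x1 [simp]: "vnorm X x = 1"
    using x by (simp_all add: unit_sphere_def)
  have Tx [simp]: "T z \<in> carrier H" if "z \<in> carrier X" for z
    using contractionsD(2)[OF T that] .
  have "1 - d < cmod (ip (T x) h)"
    using re complex_Re_le_cmod[of "ip (T x) h"] by linarith
  also have "\<dots> \<le> vnorm H (T x)"
    using h by (intro H.cauchy_schwarz_unit) auto
  finally have Tx_gt: "1 - d < vnorm H (T x)" .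
  also have "\<dots> \<le> t"
    unfolding t_def by (rule op_norm_upper[OF Tb]) auto
  finally have t_gt: "1 - d < t" .
  then have t_pos: "t > 0" using d by linarith
  have t_le: "t \<le> 1"
    unfolding t_def by (rule op_norm_least) (use contractionsD(5)[OF T] in fastforce)
  let ?c = "complex_of_real (1 / t)"
  define T' where "T' z = ?c \<odot>\<^bsub>H\<^esub> T z" for z
  have c: "cmod ?c = 1 / t"
    using t_pos by (simp only: norm_of_real) simp
  have cK: "?c \<in> K"
    by (rule X.of_real_K)
  have nT': "vnorm H (T' z) = vnorm H (T z) / t" if "z \<in> carrier X" for z
    using that cK c by (simp add: T'_def del: of_real_divide)
  have T'b: "T' \<in> bounded_operators K X H"
  proof (rule bounded_operatorsI)
    fix z assume z: "z \<in> carrier X"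
    then show "vnorm H (T' z) \<le> 1 * vnorm X z"
      using le_op_norm[OF Tb z] t_pos by (simp add: nT' pos_divide_le_eq mult.commute t_def)
  qed (use cK in \<open>simp_all add: T'_def bounded_operatorsD[OF Tb] H.smult_distr H.smult_smult mult.commute del: of_real_divide\<close>)
  have "op_norm X H T' \<le> 1"
    by (rule op_norm_least)
      (use t_pos op_norm_upper[OF Tb] in \<open>simp add: nT' t_def\<close>)
  moreover have "1 \<le> op_norm X H T'"
  proof -
    have "op_norm X H T \<le> t * op_norm X H T'"
      by (rule op_norm_least)
        (use op_norm_upper[OF T'b] nT' t_pos in \<open>simp add: field_simps\<close>)
    then show ?thesis using t_pos by (simp add: t_def[symmetric])
  qed
  ultimately have T's: "T' \<in> op_sphere K X H"
    using T'b by (simp add: op_sphere_def)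
  note T'c = op_sphere_contractions[OF T's]
  have T'x [simp]: "T' z \<in> carrier H" if "z \<in> carrier X" for z
    using contractionsD(2)[OF T'c that] .
  \<comment> \<open>Dividing by \<open>t \<le> 1\<close> cannot decrease norms, so the hypothesis of
    the BPBp survives normalization.\<close>
  have "vnorm H (T x) \<le> vnorm H (T' x)"
    using nT'[OF xc] t_pos t_le mult_left_le_one_le[of "vnorm H (T' x)" t] by simp
  then have "vnorm H (T' x) > 1 - \<eta> e"
    using Tx_gt d by linarith
  then obtain u S0 where u: "u \<in> unit_sphere X" and S0s: "S0 \<in> op_sphere K X H"
    and S0u: "vnorm H (S0 u) = 1" and ux: "vnorm X (u \<ominus>\<^bsub>X\<^esub> x) < e"
    and ST: "op_norm X H (\<lambda>z. S0 z \<ominus>\<^bsub>H\<^esub> T' z) < e"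
    using BPB e T's x unfolding BPBp_with_def by blast
  note S0c = op_sphere_contractions[OF S0s]
  have S0x [simp]: "S0 z \<in> carrier H" if "z \<in> carrier X" for z
    using contractionsD(2)[OF S0c that] .
  have uc [simp]: "u \<in> carrier X" and u1 [simp]: "vnorm X u = 1"
    using u by (simp_all add: unit_sphere_def)
  have S0T': "vnorm H (S0 z \<ominus>\<^bsub>H\<^esub> T' z) \<le> e * vnorm X z" if z: "z \<in> carrier X" for z
  proof -
    have "vnorm H (S0 z \<ominus>\<^bsub>H\<^esub> T' z) \<le> op_norm X H (\<lambda>z. S0 z \<ominus>\<^bsub>H\<^esub> T' z) * vnorm X z"
      using le_op_norm[OF bounded_operators_diff[OF contractionsD(1)[OF S0c] T'b] z] .
    also have "\<dots> \<le> e * vnorm X z"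
      using ST z by (intro mult_right_mono) auto
    finally show ?thesis .
  qed
  have T'T: "vnorm H (T' z \<ominus>\<^bsub>H\<^esub> T z) \<le> e * vnorm X z" if z: "z \<in> carrier X" for z
  proof -
    have "T' z \<ominus>\<^bsub>H\<^esub> T z = (?c - 1) \<odot>\<^bsub>H\<^esub> T z"
      using z cK H.smult_diff[of ?c 1 "T z"] by (simp add: T'_def del: of_real_divide)
    then have "vnorm H (T' z \<ominus>\<^bsub>H\<^esub> T z) = cmod (?c - 1) * vnorm H (T z)"
      using z cK by (simp del: of_real_divide)
    also have "cmod (?c - 1) = 1 / t - 1"
      using t_pos t_le by (metis norm_of_real of_real_1 of_real_diff abs_of_nonneg diff_ge_0_iff_ge le_divide_eq_1_pos)
    \<comment> \<open>Bounding by \<open>t * vnorm X z\<close> instead of \<open>vnorm X z\<close>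
      cancels the denominator and leaves the factor 1 - t, which is below \<open>d\<close>.\<close>
    also have "(1 / t - 1) * vnorm H (T z) \<le> (1 / t - 1) * (t * vnorm X z)"
      using le_op_norm[OF Tb z] t_pos t_le by (intro mult_left_mono) (auto simp: t_def)
    also have "\<dots> = (1 - t) * vnorm X z"
      using t_pos by (simp add: field_simps)
    also have "\<dots> \<le> e * vnorm X z"
      using t_gt d z by (intro mult_right_mono) auto
    finally show ?thesis .
  qed
  have Txh: "vnorm H (T x \<ominus>\<^bsub>H\<^esub> h) \<le> e"
  proof -
    have "vnorm H (T x \<ominus>\<^bsub>H\<^esub> h) \<le> sqrt (2 * d)"
      using contractionsD(5)[OF T xc] h re by (intro H.norm_minus_le_of_Re_ip) auto
    also have "\<dots> \<le> e"
      using d e by (intro real_le_lsqrt) auto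
    finally show ?thesis .
  qed
  have "vnorm H (T' u \<ominus>\<^bsub>H\<^esub> T' x) < e"
    using bounded_operators_minus[OF T'b uc xc] contractionsD(5)[OF T'c, of "u \<ominus>\<^bsub>X\<^esub> x"] ux by simp
  \<comment> \<open>Four errors of at most \<open>e\<close> along the chain \<open>S0 u\<close>,
    \<open>T' u\<close>, \<open>T' x\<close>, \<open>T x\<close>, \<open>h\<close>.\<close>
  then have "vnorm H (S0 u \<ominus>\<^bsub>H\<^esub> h) \<le> 4 * e"
    using S0T'[OF uc] T'T[OF xc] Txh h
      H.dist_triangle[of "S0 u" "T' u" h] H.dist_triangle[of "T' u" "T' x" h]
      H.dist_triangle[of "T' x" "T x" h] by simp
  then have hS0: "vnorm H (h \<ominus>\<^bsub>H\<^esub> S0 u) \<le> 4 * e"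
    using H.norm_minus_commute[of h "S0 u"] h by simp
  obtain R where R: "R \<in> contractions K H H" "R (S0 u) = h"
    and RI: "\<And>y. y \<in> carrier H \<Longrightarrow> vnorm H (R y \<ominus>\<^bsub>H\<^esub> y) \<le> 2 * vnorm H (h \<ominus>\<^bsub>H\<^esub> S0 u) * vnorm H y"
    using H.contraction_near_identity[OF S0x[OF uc] S0u h] by blast
  show thesis
  proof
    show "(\<lambda>z. R (S0 z)) \<in> contractions K X H"
      using R(1) S0c by (rule contractions_comp)
    fix z assume z: "z \<in> carrier X"
    have Rz: "R (S0 z) \<in> carrier H"
      using contractionsD(2)[OF R(1)] z by simp
    have "vnorm H (R (S0 z) \<ominus>\<^bsub>H\<^esub> S0 z) \<le> 2 * vnorm H (h \<ominus>\<^bsub>H\<^esub> S0 u) * vnorm H (S0 z)"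
      using RI z by simp
    also have "\<dots> \<le> 2 * (4 * e) * vnorm X z"
      using hS0 contractionsD(5)[OF S0c z] z h e by (intro mult_mono) auto
    \<comment> \<open>The contraction \<open>R\<close> contributes 8 e, the BPBp e, and the
      normalization e.\<close>
    finally show "vnorm H (R (S0 z) \<ominus>\<^bsub>H\<^esub> T z) \<le> 10 * e * vnorm X z"
      using S0T'[OF z] T'T[OF z] z Rz
        H.dist_triangle[of "R (S0 z)" "S0 z" "T z"] H.dist_triangle[of "S0 z" "T' z" "T z"] by simp
  qed (use u ux R(2) in auto)
qed

section \<open>Sums of type \<open>\<ell>\<^sub>1\<close>\<close>

text \<open>The tail of a family outside \<open>F\<close>. Applying an operator to it describes the
  part left unchanged without an infinite sum in \<open>H\<close>.\<close>

definition l1_cut :: "'i set \<Rightarrow> ('i \<Rightarrow> 'a nspace) \<Rightarrow> 'i set \<Rightarrow> ('i \<Rightarrow> 'a) \<Rightarrow> 'i \<Rightarrow> 'a" where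
  "l1_cut I X F x = (\<lambda>i\<in>I. if i \<in> F then \<zero>\<^bsub>X i\<^esub> else x i)"

text \<open>The canonical embedding of the summand with index \<open>j\<close>.\<close>

definition l1_single :: "'i set \<Rightarrow> ('i \<Rightarrow> 'a nspace) \<Rightarrow> 'i \<Rightarrow> 'a \<Rightarrow> 'i \<Rightarrow> 'a" where
  "l1_single I X j v = (\<lambda>i\<in>I. if i = j then v else \<zero>\<^bsub>X i\<^esub>)"

lemma l1_sum_simps [simp]:
  "x \<in> carrier (l1_sum I X) \<longleftrightarrow>
     x \<in> (\<Pi>\<^sub>E i\<in>I. carrier (X i)) \<and> (\<lambda>i. vnorm (X i) (x i)) summable_on I"
  "\<zero>\<^bsub>l1_sum I X\<^esub> = (\<lambda>i\<in>I. \<zero>\<^bsub>X i\<^esub>)"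
  "x \<oplus>\<^bsub>l1_sum I X\<^esub> y = (\<lambda>i\<in>I. x i \<oplus>\<^bsub>X i\<^esub> y i)"
  "c \<odot>\<^bsub>l1_sum I X\<^esub> x = (\<lambda>i\<in>I. c \<odot>\<^bsub>X i\<^esub> x i)"
  "vnorm (l1_sum I X) x = (\<Sum>\<^sub>\<infinity>i\<in>I. vnorm (X i) (x i))"
  by (simp_all add: l1_sum_def)

text \<open>\<open>cring_K\<close> is assumed separately because for empty \<open>I\<close> no
  summand provides it.\<close>

locale l1_family =
  fixes K :: "complex set" and I :: "'i set" and X :: "'i \<Rightarrow> 'a nspace"
  assumes summand: "i \<in> I \<Longrightarrow> nspace K (X i)"
    and cring_K: "cring (scalars K)" and reals_K: "\<real> \<subseteq> K"
begin

abbreviation L where "L \<equiv> l1_sum I X"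

lemma abelian_group_summand: "i \<in> I \<Longrightarrow> abelian_group (X i)"
  using nspace.ns[OF summand] unfolding normed_space_def by (blast intro: module.axioms(2))

lemma abelian_monoid_summand: "i \<in> I \<Longrightarrow> abelian_monoid (X i)"
  by (simp add: abelian_group_summand abelian_group.axioms(1))

text \<open>No single interpretation of \<open>nspace\<close> covers a varying \<open>X i\<close>,
  so frequent facts are offered to the simplifier with the premise \<open>i \<in> I\<close>.\<close>

lemmas summand_simps [simp] =
  abelian_monoid.zero_closed[OF abelian_monoid_summand]
  abelian_monoid.a_closed[OF abelian_monoid_summand]
  abelian_monoid.l_zero[OF abelian_monoid_summand]
  abelian_monoid.r_zero[OF abelian_monoid_summand]
  nspace.smult_closed'[OF summand]
  nspace.smult_1[OF summand]
  nspace.smult_0_right[OF summand]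
  nspace.norm_nonneg[OF summand]
  nspace.norm_zero[OF summand]
  nspace.norm_smult[OF summand]

lemma coord_closed [simp]: "x \<in> (\<Pi>\<^sub>E i\<in>I. carrier (X i)) \<Longrightarrow> i \<in> I \<Longrightarrow> x i \<in> carrier (X i)"
  by (rule PiE_mem)

lemma l1_add_closed:
  assumes "x \<in> carrier L" "y \<in> carrier L"
  shows "x \<oplus>\<^bsub>L\<^esub> y \<in> carrier L"
proof -
  have "(\<lambda>i. vnorm (X i) (x i \<oplus>\<^bsub>X i\<^esub> y i)) summable_on I"
    by (rule summable_on_comparison_test[OF summable_on_add[of "\<lambda>i. vnorm (X i) (x i)" I "\<lambda>i. vnorm (X i) (y i)"]])
      (use assms nspace.norm_triangle[OF summand] in auto)
  then have "(\<lambda>i. vnorm (X i) ((x \<oplus>\<^bsub>L\<^esub> y) i)) summable_on I"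
    by (simp cong: summable_on_cong)
  then show ?thesis
    using assms by simp
qed

lemma l1_smult_closed:
  assumes "c \<in> K" "x \<in> carrier L"
  shows "c \<odot>\<^bsub>L\<^esub> x \<in> carrier L"
proof -
  have "(\<lambda>i. cmod c * vnorm (X i) (x i)) summable_on I"
    using assms by (intro summable_on_cmult_right) auto
  moreover have "(\<lambda>i. cmod c * vnorm (X i) (x i)) summable_on I \<longleftrightarrow>
      (\<lambda>i. vnorm (X i) ((c \<odot>\<^bsub>L\<^esub> x) i)) summable_on I"
    by (rule summable_on_cong) (use assms in auto)
  ultimately show ?thesis
    using assms by simp
qed

lemma l1_zero_closed: "\<zero>\<^bsub>L\<^esub> \<in> carrier L"
proof -
  have "(\<lambda>i. vnorm (X i) (\<zero>\<^bsub>L\<^esub> i)) summable_on I \<longleftrightarrow> (\<lambda>i. 0 :: real) summable_on I"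
    by (rule summable_on_cong) auto
  then show ?thesis by auto
qed

lemma l1_eqI:
  "x \<in> carrier L \<Longrightarrow> y \<in> carrier L \<Longrightarrow> (\<And>i. i \<in> I \<Longrightarrow> x i = y i) \<Longrightarrow> x = y"
  using PiE_ext[of x I "\<lambda>i. carrier (X i)" y] by simp

lemma l1_module: "module (scalars K) L"
proof (rule moduleI[OF cring_K])
  show "abelian_group L"
  proof (rule abelian_groupI)
    fix x y z assume "x \<in> carrier L" "y \<in> carrier L" "z \<in> carrier L"
    then show "(x \<oplus>\<^bsub>L\<^esub> y) \<oplus>\<^bsub>L\<^esub> z = x \<oplus>\<^bsub>L\<^esub> (y \<oplus>\<^bsub>L\<^esub> z)"
      by (auto simp: abelian_monoid.a_assoc[OF abelian_monoid_summand])
  next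
    fix x y assume "x \<in> carrier L" "y \<in> carrier L"
    then show "x \<oplus>\<^bsub>L\<^esub> y = y \<oplus>\<^bsub>L\<^esub> x"
      by (auto simp: abelian_monoid.a_comm[OF abelian_monoid_summand] intro!: restrict_ext)
  next
    fix x assume x: "x \<in> carrier L"
    show "\<zero>\<^bsub>L\<^esub> \<oplus>\<^bsub>L\<^esub> x = x"
      by (rule l1_eqI[OF l1_add_closed[OF l1_zero_closed x] x]) (use x in auto)
    \<comment> \<open>The additive inverse is the multiple by \<open>- 1\<close>, whose summability
      is known from \<open>l1_smult_closed\<close>.\<close>
    have "- 1 \<in> K"
      using reals_K by auto
    then have "(- 1) \<odot>\<^bsub>L\<^esub> x \<in> carrier L"
      using x by (rule l1_smult_closed)
    moreover have "(- 1) \<odot>\<^bsub>L\<^esub> x \<oplus>\<^bsub>L\<^esub> x = \<zero>\<^bsub>L\<^esub>"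
      using x by (auto simp: nspace.a_inv_smult[OF summand, symmetric]
          abelian_group.l_neg[OF abelian_group_summand] intro!: restrict_ext)
    ultimately show "\<exists>y\<in>carrier L. y \<oplus>\<^bsub>L\<^esub> x = \<zero>\<^bsub>L\<^esub>"
      by blast
  qed (rule l1_add_closed l1_zero_closed; assumption)+
next
  fix c x assume "c \<in> carrier (scalars K)" "x \<in> carrier L"
  then show "c \<odot>\<^bsub>L\<^esub> x \<in> carrier L"
    by (simp only: scalars_simps l1_smult_closed)
next
  fix c d x assume *: "c \<in> carrier (scalars K)" "d \<in> carrier (scalars K)" "x \<in> carrier L"
  then show "(c \<oplus>\<^bsub>scalars K\<^esub> d) \<odot>\<^bsub>L\<^esub> x = c \<odot>\<^bsub>L\<^esub> x \<oplus>\<^bsub>L\<^esub> d \<odot>\<^bsub>L\<^esub> x"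
    by (auto simp: nspace.smult_add[OF summand] intro!: restrict_ext)
  show "(c \<otimes>\<^bsub>scalars K\<^esub> d) \<odot>\<^bsub>L\<^esub> x = c \<odot>\<^bsub>L\<^esub> (d \<odot>\<^bsub>L\<^esub> x)"
    using * by (auto simp: nspace.smult_smult[OF summand] intro!: restrict_ext)
next
  fix c x y assume "c \<in> carrier (scalars K)" "x \<in> carrier L" "y \<in> carrier L"
  then show "c \<odot>\<^bsub>L\<^esub> (x \<oplus>\<^bsub>L\<^esub> y) = c \<odot>\<^bsub>L\<^esub> x \<oplus>\<^bsub>L\<^esub> c \<odot>\<^bsub>L\<^esub> y"
    by (auto simp: nspace.smult_distr[OF summand] intro!: restrict_ext)
next
  fix x assume x: "x \<in> carrier L"
  have "1 \<in> K"
    using reals_K by auto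
  then show "\<one>\<^bsub>scalars K\<^esub> \<odot>\<^bsub>L\<^esub> x = x"
    using x by (intro l1_eqI) (simp_all only: scalars_simps l1_smult_closed, auto)
qed

lemma l1_nspace: "nspace K L"
proof (rule nspace.intro[OF _ reals_K])
  have "vnorm L x = 0 \<longleftrightarrow> x = \<zero>\<^bsub>L\<^esub>" if x: "x \<in> carrier L" for x
  proof
    assume "vnorm L x = 0"
    then have "vnorm (X i) (x i) = 0" if "i \<in> I" for i
      using x that nonneg_infsum_le_0D[of "\<lambda>i. vnorm (X i) (x i)" I i] by auto
    then have "x i = \<zero>\<^bsub>X i\<^esub>" if "i \<in> I" for i
      using x that nspace.norm_eq_0[OF summand] by auto
    then show "x = \<zero>\<^bsub>L\<^esub>"
      by (intro l1_eqI[OF x l1_zero_closed]) simp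
  next
    assume x: "x = \<zero>\<^bsub>L\<^esub>"
    show "vnorm L x = 0"
      unfolding l1_sum_simps x by (rule infsum_0) simp
  qed
  moreover have "vnorm L x \<ge> 0" if "x \<in> carrier L" for x
    using that by (simp add: infsum_nonneg)
  moreover have "vnorm L (c \<odot>\<^bsub>L\<^esub> x) = cmod c * vnorm L x" if "c \<in> K" "x \<in> carrier L" for c x
  proof -
    have "vnorm L (c \<odot>\<^bsub>L\<^esub> x) = (\<Sum>\<^sub>\<infinity>i\<in>I. cmod c * vnorm (X i) (x i))"
      unfolding l1_sum_simps by (rule infsum_cong) (use that in auto)
    then show ?thesis by (simp add: infsum_cmult_right')
  qed
  moreover have "vnorm L (x \<oplus>\<^bsub>L\<^esub> y) \<le> vnorm L x + vnorm L y"
    if x: "x \<in> carrier L" and y: "y \<in> carrier L" for x y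
  proof -
    have "vnorm L (x \<oplus>\<^bsub>L\<^esub> y) \<le> (\<Sum>\<^sub>\<infinity>i\<in>I. vnorm (X i) (x i) + vnorm (X i) (y i))"
      using l1_add_closed[OF x y] x y nspace.norm_triangle[OF summand]
      by (auto intro!: infsum_mono summable_on_add)
    then show ?thesis
      using x y by (simp add: infsum_add)
  qed
  ultimately show "normed_space K L"
    unfolding normed_space_def using l1_module by blast
qed

sublocale L: nspace K L
  by (rule l1_nspace)

lemma l1_minus_apply:
  assumes "x \<in> carrier L" "y \<in> carrier L" "i \<in> I"
  shows "(x \<ominus>\<^bsub>L\<^esub> y) i = x i \<ominus>\<^bsub>X i\<^esub> y i"
  using assms L.minus_smult[OF assms(1,2)] nspace.minus_smult[OF summand] by simp

lemma l1_single:
  assumes j: "j \<in> I"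
  shows "l1_single I X j \<in> contractions K (X j) L"
proof (rule contractionsI)
  fix v assume v: "v \<in> carrier (X j)"
  let ?f = "\<lambda>i. vnorm (X i) (l1_single I X j v i)"
  have "?f summable_on I \<longleftrightarrow> ?f summable_on {j}"
    by (rule summable_on_cong_neutral) (use j in \<open>auto simp: l1_single_def\<close>)
  then show "l1_single I X j v \<in> carrier L"
    using j v by (auto simp: l1_single_def)
  have "infsum ?f I = infsum ?f {j}"
    by (rule infsum_cong_neutral) (use j in \<open>auto simp: l1_single_def\<close>)
  also have "\<dots> = vnorm (X j) v"
    using j by (simp add: l1_single_def)
  finally show "vnorm L (l1_single I X j v) \<le> vnorm (X j) v"
    by simp
qed (use j in \<open>auto simp: l1_single_def intro!: restrict_ext\<close>)

lemma l1_cut_closed: "x \<in> carrier L \<Longrightarrow> l1_cut I X F x \<in> carrier L"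
proof -
  assume x: "x \<in> carrier L"
  have "(\<lambda>i. vnorm (X i) (l1_cut I X F x i)) summable_on I"
    by (rule summable_on_comparison_test[of "\<lambda>i. vnorm (X i) (x i)"])
      (use x in \<open>auto simp: l1_cut_def\<close>)
  then show ?thesis
    using x by (auto simp: l1_cut_def)
qed

text \<open>Additivity of the norm over disjoint sets of coordinates, the feature of the sum behind
  gluing and behind the distance estimates below.\<close>

lemma norm_l1_cut:
  assumes x: "x \<in> carrier L" and F: "finite F" "F \<subseteq> I"
  shows "vnorm L (l1_cut I X F x) + (\<Sum>i\<in>F. vnorm (X i) (x i)) = vnorm L x"
proof -
  let ?n = "\<lambda>i. vnorm (X i) (x i)"
  have "vnorm L (l1_cut I X F x) = infsum ?n (I - F)"
    unfolding l1_sum_simps by (rule infsum_cong_neutral) (auto simp: l1_cut_def)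
  moreover have "infsum ?n (I - F \<union> F) = infsum ?n (I - F) + infsum ?n F"
    by (rule infsum_Un_disjoint) (use x F in \<open>auto intro: summable_on_subset\<close>)
  moreover have "I - F \<union> F = I"
    using F by auto
  ultimately show ?thesis
    using F by simp
qed

lemma l1_cut:
  assumes F: "finite F" "F \<subseteq> I"
  shows "l1_cut I X F \<in> contractions K L L"
proof (rule contractionsI)
  fix x assume x: "x \<in> carrier L"
  then show "l1_cut I X F x \<in> carrier L"
    by (rule l1_cut_closed)
  have "(\<Sum>i\<in>F. vnorm (X i) (x i)) \<ge> 0"
    using F x by (intro sum_nonneg) auto
  then show "vnorm L (l1_cut I X F x) \<le> vnorm L x"
    using norm_l1_cut[OF x F] by linarith
qed (auto simp: l1_cut_def intro!: restrict_ext)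

lemma l1_cut_insert:
  assumes "x \<in> carrier L" "j \<in> I" "j \<notin> F"
  shows "l1_cut I X F x = l1_cut I X (insert j F) x \<oplus>\<^bsub>L\<^esub> l1_single I X j (x j)"
  using assms by (auto simp: l1_cut_def l1_single_def intro!: restrict_ext)

lemma l1_cut_empty: "x \<in> carrier L \<Longrightarrow> l1_cut I X {} x = x"
  by (rule l1_eqI[OF l1_cut_closed]) (auto simp: l1_cut_def)

end

section \<open>Splitting and gluing operators on the sum\<close>

locale l1_family_hilbert = l1_family K I X + H: inner_product_space K H ip
  for K :: "complex set" and I :: "'i set" and X :: "'i \<Rightarrow> 'a nspace"
    and H :: "'h nspace" and ip :: "'h \<Rightarrow> 'h \<Rightarrow> complex"
begin

sublocale LH: nspace_pair K L H
  by (intro nspace_pair.intro l1_nspace H.nspace_axioms)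

sublocale LL: nspace_pair K L L
  by (intro nspace_pair.intro l1_nspace)

text \<open>Peels off one coordinate of \<open>F\<close> at a time; a finite substitute for
  expanding \<open>T x\<close> into a series over all coordinates.\<close>

lemma operator_split:
  assumes T: "T \<in> bounded_operators K L H" and x: "x \<in> carrier L" and F: "finite F" "F \<subseteq> I"
  shows "T x = T (l1_cut I X F x) \<oplus>\<^bsub>H\<^esub> finsum H (\<lambda>i. T (l1_single I X i (x i))) F"
  using F
proof (induction F)
  case empty
  have "T x \<in> carrier H"
    using bounded_operatorsD(1)[OF T x] .
  then show ?case
    using x by (simp add: l1_cut_empty del: l1_sum_simps)
next
  case (insert j F)
  have c: "T (l1_single I X i (x i)) \<in> carrier H" if "i \<in> insert j F" for i
  proof (rule bounded_operatorsD(1)[OF T contractionsD(2)[OF l1_single]])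
    show "i \<in> I" "x i \<in> carrier (X i)"
      using that insert.prems x by auto
  qed
  have j: "j \<in> I"
    using insert.prems by simp
  have single: "l1_single I X j (x j) \<in> carrier L"
    using contractionsD(2)[OF l1_single[OF j]] x j by simp
  note cut = l1_cut_closed[OF x, of "insert j F"]
  have "T (l1_cut I X F x) = T (l1_cut I X (insert j F) x) \<oplus>\<^bsub>H\<^esub> T (l1_single I X j (x j))"
    using l1_cut_insert[OF x j insert.hyps(2)] bounded_operatorsD(2)[OF T cut single] by simp
  moreover have "finsum H (\<lambda>i. T (l1_single I X i (x i))) F \<in> carrier H"
    using c by (intro H.finsum_closed) auto
  moreover have "finsum H (\<lambda>i. T (l1_single I X i (x i))) (insert j F)
      = T (l1_single I X j (x j)) \<oplus>\<^bsub>H\<^esub> finsum H (\<lambda>i. T (l1_single I X i (x i))) F"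
    using c insert.hyps by (intro H.finsum_insert) auto
  ultimately show ?case
    using insert.IH insert.prems c bounded_operatorsD(1)[OF T cut] by (simp add: H.a_assoc)
qed

text \<open>By the triangle inequality the value has norm at most that of the tail plus the
  coordinate norms on \<open>F\<close>, and in the sum these add up to exactly the norm of the
  argument.\<close>

lemma contractions_glue:
  assumes T: "T \<in> contractions K L H" and F: "finite F" "F \<subseteq> I"
    and S: "\<And>i. i \<in> F \<Longrightarrow> S i \<in> contractions K (X i) H"
  shows "(\<lambda>z. T (l1_cut I X F z) \<oplus>\<^bsub>H\<^esub> finsum H (\<lambda>i. S i (z i)) F) \<in> contractions K L H"
proof -
  have Tc: "(\<lambda>z. T (l1_cut I X F z)) \<in> contractions K L H"
    by (rule contractions_comp[OF T l1_cut[OF F]])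
  have Sc [simp]: "S i (z i) \<in> carrier H" if "i \<in> F" "z \<in> carrier L" for i z
    using contractionsD(2)[OF S[OF that(1)], of "z i"] that F by auto
  then have fc [simp]: "finsum H (\<lambda>i. S i (z i)) F \<in> carrier H" if "z \<in> carrier L" for z
    using that by (intro H.finsum_closed) (auto simp del: l1_sum_simps)
  show ?thesis
  proof (rule contractionsI)
    fix x assume x: "x \<in> carrier L"
    show "T (l1_cut I X F x) \<oplus>\<^bsub>H\<^esub> finsum H (\<lambda>i. S i (x i)) F \<in> carrier H"
      using contractionsD(2)[OF Tc x] x by (simp del: l1_sum_simps)
    have "vnorm H (finsum H (\<lambda>i. S i (x i)) F) \<le> (\<Sum>i\<in>F. vnorm H (S i (x i)))"
      using x by (intro H.norm_finsum F) (auto simp del: l1_sum_simps)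
    also have "\<dots> \<le> (\<Sum>i\<in>F. vnorm (X i) (x i))"
      using x F by (intro sum_mono contractionsD(5)[OF S]) auto
    finally show "vnorm H (T (l1_cut I X F x) \<oplus>\<^bsub>H\<^esub> finsum H (\<lambda>i. S i (x i)) F) \<le> vnorm L x"
      using norm_l1_cut[OF x F] contractionsD(5)[OF T l1_cut_closed[OF x, of F]]
        H.norm_triangle[OF contractionsD(2)[OF Tc x] fc[OF x]] by linarith
  next
    fix x y assume x: "x \<in> carrier L" and y: "y \<in> carrier L"
    have "finsum H (\<lambda>i. S i ((x \<oplus>\<^bsub>L\<^esub> y) i)) F = finsum H (\<lambda>i. S i (x i) \<oplus>\<^bsub>H\<^esub> S i (y i)) F"
      by (rule H.finsum_cong') (use x y F contractionsD(3)[OF S] in auto)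
    also have "\<dots> = finsum H (\<lambda>i. S i (x i)) F \<oplus>\<^bsub>H\<^esub> finsum H (\<lambda>i. S i (y i)) F"
      using x y by (intro H.finsum_addf) (auto simp del: l1_sum_simps)
    finally show "T (l1_cut I X F (x \<oplus>\<^bsub>L\<^esub> y)) \<oplus>\<^bsub>H\<^esub> finsum H (\<lambda>i. S i ((x \<oplus>\<^bsub>L\<^esub> y) i)) F
        = (T (l1_cut I X F x) \<oplus>\<^bsub>H\<^esub> finsum H (\<lambda>i. S i (x i)) F)
          \<oplus>\<^bsub>H\<^esub> (T (l1_cut I X F y) \<oplus>\<^bsub>H\<^esub> finsum H (\<lambda>i. S i (y i)) F)"
      using contractionsD(2)[OF Tc x] contractionsD(2)[OF Tc y] contractionsD(3)[OF Tc x y]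
        fc[OF x] fc[OF y] by (simp add: H.a_ac del: l1_sum_simps)
  next
    fix c x assume c: "c \<in> K" and x: "x \<in> carrier L"
    have "finsum H (\<lambda>i. S i ((c \<odot>\<^bsub>L\<^esub> x) i)) F = finsum H (\<lambda>i. c \<odot>\<^bsub>H\<^esub> S i (x i)) F"
      by (rule H.finsum_cong') (use c x F contractionsD(4)[OF S] in auto)
    also have "\<dots> = c \<odot>\<^bsub>H\<^esub> finsum H (\<lambda>i. S i (x i)) F"
      using c x F by (intro H.finsum_smult_ldistr[symmetric]) (auto simp del: l1_sum_simps)
    finally show "T (l1_cut I X F (c \<odot>\<^bsub>L\<^esub> x)) \<oplus>\<^bsub>H\<^esub> finsum H (\<lambda>i. S i ((c \<odot>\<^bsub>L\<^esub> x) i)) F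
        = c \<odot>\<^bsub>H\<^esub> (T (l1_cut I X F x) \<oplus>\<^bsub>H\<^esub> finsum H (\<lambda>i. S i (x i)) F)"
      using contractionsD(2)[OF Tc x] contractionsD(4)[OF Tc c x] fc[OF x] c
      by (simp add: H.smult_distr del: l1_sum_simps)
  qed
qed

end

section \<open>The BPBp of the sum\<close>

text \<open>Here \<open>e\<close> is the accuracy in each summand and \<open>d\<close> the relative
  loss tolerated there. One half of \<open>d * e\<close> pays for the defect of \<open>T x\<close>,
  the other for truncation to a finite set. As in Markov's inequality, a total defect below
  \<open>d * e\<close> leaves mass below \<open>e\<close> on coordinates losing a proportion
  \<open>d\<close> or more.\<close>

lemma (in l1_family_hilbert) BPBp_with_l1_sum:
  assumes BPB: "\<And>i. i \<in> I \<Longrightarrow> BPBp_with \<eta> K (X i) H"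
    and T: "T \<in> op_sphere K L H" and x: "x \<in> unit_sphere L"
    and e: "0 < e" "e \<le> 1 / 20" and d: "0 < d" "d \<le> \<eta> e" "d \<le> e" "d \<le> e\<^sup>2 / 2" "d \<le> 1 / 2"
    and Tx: "vnorm H (T x) > 1 - d * e / 2"
  obtains u S where "u \<in> unit_sphere L" "S \<in> op_sphere K L H" "vnorm H (S u) = 1"
    "vnorm L (u \<ominus>\<^bsub>L\<^esub> x) < 5 * e" "op_norm L H (\<lambda>z. S z \<ominus>\<^bsub>H\<^esub> T z) \<le> 10 * e"
proof -
  \<comment> \<open>The operations of \<open>L\<close> stay folded so that the general rules for
    \<open>nspace\<close> match.\<close>
  note [simp del] = l1_sum_simps
  note Tc = LH.op_sphere_contractions[OF T]
  note Tb = contractionsD(1)[OF Tc]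
  have xc: "x \<in> carrier L" and x1: "vnorm L x = 1"
    using x by (simp_all add: unit_sphere_def)
  have coord: "z i \<in> carrier (X i)" if "z \<in> carrier L" "i \<in> I" for z i
    using that by (simp add: l1_sum_simps)
  define n where "n i = vnorm (X i) (x i)" for i
  have n0: "n i \<ge> 0" if "i \<in> I" for i
    using that coord[OF xc] by (simp add: n_def)
  define Ti where "Ti i v = T (l1_single I X i v)" for i v
  have Tic: "Ti i \<in> contractions K (X i) H" if "i \<in> I" for i
    unfolding Ti_def by (rule contractions_comp[OF Tc l1_single[OF that]])
  have Tx_closed: "T x \<in> carrier H"
    using contractionsD(2)[OF Tc xc] .
  define t where "t = vnorm H (T x)"
  have de: "0 < d * e" "d * e \<le> e" "d * e < 1 / 20"
  proof -
    show "0 < d * e" using d e by simp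
    have "d * e \<le> 1 / 2 * e" using d e by (intro mult_right_mono) auto
    then show "d * e \<le> e" "d * e < 1 / 20" using e by linarith+
  qed
  have t: "t > 1 - d * e / 2" "t > 0"
    using Tx de by (auto simp: t_def)
  \<comment> \<open>The direction of \<open>T x\<close>, so that <T x, h> is the positive real
    \<open>t\<close>.\<close>
  define h where "h = complex_of_real (1 / t) \<odot>\<^bsub>H\<^esub> T x"
  have ct: "cmod (complex_of_real (1 / t)) = 1 / t"
    using t by (simp only: norm_of_real) simp
  have h: "h \<in> carrier H" "vnorm H h = 1"
    using Tx_closed t ct by (simp_all add: h_def t_def[symmetric] del: of_real_divide)
  have "ip (T x) h = cnj (complex_of_real (1 / t)) * ip (T x) (T x)"
    unfolding h_def by (rule H.ip_smult_right[OF H.of_real_K Tx_closed Tx_closed])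
  also have "\<dots> = complex_of_real (1 / t * t\<^sup>2)"
    by (simp add: H.ip_self[OF Tx_closed] t_def[symmetric])
  finally have re_Tx: "Re (ip (T x) h) > 1 - d * e / 2"
    using t by (simp add: power2_eq_square)

  \<comment> \<open>A finite set carries all but \<open>d * e / 2\<close> of the norm of
    \<open>x\<close>, whatever the cardinality of \<open>I\<close>.\<close>
  obtain F0 where F0: "finite F0" "F0 \<subseteq> I" and "dist (sum n F0) (infsum n I) \<le> d * e / 2"
    using infsum_finite_approximation[of n I "d * e / 2"] xc de
    by (auto simp: l1_sum_simps n_def[abs_def])
  then have sF0: "sum n F0 \<ge> 1 - d * e / 2"
    using x1 unfolding dist_real_def abs_le_iff by (simp add: l1_sum_simps n_def[abs_def])
  have sF0_le: "sum n F0 \<le> 1"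
    using norm_l1_cut[OF xc F0] x1 L.norm_nonneg[OF l1_cut_closed[OF xc, of F0]]
    by (simp add: n_def)
  define r where "r i = Re (ip (Ti i (x i)) h)" for i
  have Ti_closed: "Ti i (x i) \<in> carrier H" if "i \<in> I" for i
    using contractionsD(2)[OF Tic[OF that] coord[OF xc that]] .
  have r_le: "r i \<le> n i" if "i \<in> I" for i
  proof -
    have "r i \<le> cmod (ip (Ti i (x i)) h)"
      unfolding r_def by (rule complex_Re_le_cmod)
    also have "\<dots> \<le> vnorm H (Ti i (x i))"
      by (rule H.cauchy_schwarz_unit[OF Ti_closed[OF that] h])
    also have "\<dots> \<le> n i"
      unfolding n_def by (rule contractionsD(5)[OF Tic[OF that] coord[OF xc that]])
    finally show ?thesis .
  qed
  \<comment> \<open>The tail of \<open>x\<close> costs at most \<open>d * e / 2\<close>, on top of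
    the defect in \<open>re_Tx\<close>.\<close>
  have sum_r: "sum r F0 > 1 - d * e"
  proof -
    let ?c = "T (l1_cut I X F0 x)"
    have c: "?c \<in> carrier H"
      using contractionsD(2)[OF Tc l1_cut_closed[OF xc]] .
    have f: "(\<lambda>i. Ti i (x i)) \<in> F0 \<rightarrow> carrier H"
      using Ti_closed F0 by auto
    have "T x = ?c \<oplus>\<^bsub>H\<^esub> finsum H (\<lambda>i. Ti i (x i)) F0"
      unfolding Ti_def by (rule operator_split[OF Tb xc F0])
    then have "Re (ip (T x) h) = Re (ip ?c h) + sum r F0"
      using c h H.finsum_closed[OF f] H.Re_ip_finsum[OF F0(1) f h(1)]
      by (simp add: H.ip_add_left r_def)
    moreover have "Re (ip ?c h) \<le> vnorm H ?c"
      using complex_Re_le_cmod[of "ip ?c h"] H.cauchy_schwarz_unit[OF c h] by linarith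
    moreover have "vnorm H ?c \<le> vnorm L (l1_cut I X F0 x)"
      by (rule contractionsD(5)[OF Tc l1_cut_closed[OF xc]])
    moreover have "vnorm L (l1_cut I X F0 x) \<le> d * e / 2"
      using norm_l1_cut[OF xc F0] sF0 x1 by (simp add: n_def)
    ultimately show ?thesis
      using re_Tx by (simp add: field_simps)
  qed

  \<comment> \<open>The good coordinates. Each other one in \<open>F0\<close> loses at least
    \<open>d * n i\<close> of a total loss below \<open>d * e\<close>.\<close>
  define F where "F = {i \<in> F0. r i > (1 - d) * n i}"
  have F: "finite F" "F \<subseteq> I" "F \<subseteq> F0"
    using F0 by (auto simp: F_def)
  define s where "s = sum n F"
  have split: "sum g F0 = sum g F + sum g (F0 - F)" for g :: "'i \<Rightarrow> real"
    using sum.subset_diff[OF F(3) F0(1), of g] by simp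
  have "sum r F \<le> sum n F"
    using F r_le by (intro sum_mono) auto
  moreover have "sum r (F0 - F) \<le> (1 - d) * sum n (F0 - F)"
    unfolding sum_distrib_left by (rule sum_mono) (auto simp: F_def)
  ultimately have "sum r F0 \<le> sum n F0 - d * sum n (F0 - F)"
    unfolding split[of r] split[of n] by (simp add: algebra_simps)
  then have "d * sum n (F0 - F) < d * e"
    using sum_r sF0_le by linarith
  then have "sum n (F0 - F) < e"
    using d by simp
  moreover have "sum n (F0 - F) \<ge> 0"
    using n0 F0 by (intro sum_nonneg) auto
  \<comment> \<open>Truncation removes at most \<open>d * e / 2\<close> of the mass, the bad
    coordinates less than \<open>e\<close>.\<close>
  ultimately have s: "s > 1 - 2 * e" "s > 0" "s \<le> 1"
    unfolding s_def using e de sF0 sF0_le split[of n] by linarith+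

  \<comment> \<open>A zero coordinate would give \<open>r i \<le> 0\<close>, against the strict
    inequality defining \<open>F\<close>.\<close>
  have npos: "n i > 0" if "i \<in> F" for i
  proof (rule ccontr)
    assume "\<not> n i > 0"
    then have "n i = 0" using n0 that F by force
    then show False using r_le[of i] that F by (auto simp: F_def)
  qed
  define y where "y i = complex_of_real (1 / n i) \<odot>\<^bsub>X i\<^esub> x i" for i
  have cn: "cmod (complex_of_real (1 / n i)) = 1 / n i" if "i \<in> F" for i
    using npos[OF that] by (simp only: norm_of_real) simp
  have y: "y i \<in> unit_sphere (X i)" if "i \<in> F" for i
    using that F npos[OF that] cn[OF that] coord[OF xc]
    by (auto simp: y_def unit_sphere_def n_def[symmetric] simp del: of_real_divide)
  have x_eq: "x i = complex_of_real (n i) \<odot>\<^bsub>X i\<^esub> y i" if "i \<in> F" for i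
  proof -
    interpret nspace K "X i" using that F summand by auto
    have "complex_of_real (n i) * complex_of_real (1 / n i) = 1"
      using npos[OF that] by simp
    then show ?thesis
      using that F coord[OF xc] smult_smult[of "complex_of_real (n i)" "complex_of_real (1 / n i)" "x i"]
      by (auto simp: y_def simp del: of_real_divide)
  qed
  have re_y: "Re (ip (Ti i (y i)) h) > 1 - d" if i: "i \<in> F" for i
  proof -
    have iI: "i \<in> I" using i F by auto
    have "Ti i (y i) = complex_of_real (1 / n i) \<odot>\<^bsub>H\<^esub> Ti i (x i)"
      unfolding y_def by (rule contractionsD(4)[OF Tic[OF iI] H.of_real_K coord[OF xc iI]])
    then have "ip (Ti i (y i)) h = complex_of_real (1 / n i) * ip (Ti i (x i)) h"
      using H.ip_smult_left[OF H.of_real_K Ti_closed[OF iI] h(1)] by (simp only:)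
    then have "Re (ip (Ti i (y i)) h) = r i / n i"
      by (simp add: r_def Re_divide_of_real)
    then show ?thesis
      using npos[OF i] i by (simp add: F_def pos_less_divide_eq)
  qed
  \<comment> \<open>Packed into one statement so that \<open>v\<close> and \<open>S'\<close> can be
    chosen as functions on \<open>F\<close>; the attained value \<open>h\<close> is the same for all
    \<open>i\<close>.\<close>
  have "\<forall>i\<in>F. \<exists>v S. v \<in> unit_sphere (X i) \<and> S \<in> contractions K (X i) H \<and> S v = h \<and>
      vnorm (X i) (v \<ominus>\<^bsub>X i\<^esub> y i) < e \<and>
      (\<forall>z\<in>carrier (X i). vnorm H (S z \<ominus>\<^bsub>H\<^esub> Ti i z) \<le> 10 * e * vnorm (X i) z)"
  proof
    fix i assume i: "i \<in> F"
    then have iI: "i \<in> I" using F by auto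
    show "\<exists>v S. v \<in> unit_sphere (X i) \<and> S \<in> contractions K (X i) H \<and> S v = h \<and>
      vnorm (X i) (v \<ominus>\<^bsub>X i\<^esub> y i) < e \<and>
      (\<forall>z\<in>carrier (X i). vnorm H (S z \<ominus>\<^bsub>H\<^esub> Ti i z) \<le> 10 * e * vnorm (X i) z)"
      using BPBp_with_rotated[OF summand[OF iI] H.inner_product_space_axioms BPB[OF iI] Tic[OF iI]
          y[OF i] h re_y[OF i] e(1) d(2-5)] by metis
  qed
  then obtain v S' where
    v: "\<And>i. i \<in> F \<Longrightarrow> v i \<in> unit_sphere (X i)" and
    S'c: "\<And>i. i \<in> F \<Longrightarrow> S' i \<in> contractions K (X i) H" and
    S'v: "\<And>i. i \<in> F \<Longrightarrow> S' i (v i) = h" and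
    vy: "\<And>i. i \<in> F \<Longrightarrow> vnorm (X i) (v i \<ominus>\<^bsub>X i\<^esub> y i) < e" and
    S'T: "\<And>i z. i \<in> F \<Longrightarrow> z \<in> carrier (X i) \<Longrightarrow>
      vnorm H (S' i z \<ominus>\<^bsub>H\<^esub> Ti i z) \<le> 10 * e * vnorm (X i) z"
    by metis
  have vc: "v i \<in> carrier (X i)" "vnorm (X i) (v i) = 1"
    and yc: "y i \<in> carrier (X i)" "vnorm (X i) (y i) = 1" if "i \<in> F" for i
    using v y that by (auto simp: unit_sphere_def)

  \<comment> \<open>Dividing by \<open>s\<close> makes the weights sum to 1, so \<open>u\<close> is
    a unit vector with support in the finite set \<open>F\<close>.\<close>
  define u where "u = (\<lambda>i\<in>I. if i \<in> F then complex_of_real (n i / s) \<odot>\<^bsub>X i\<^esub> v i else \<zero>\<^bsub>X i\<^esub>)"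
  define S where "S z = T (l1_cut I X F z) \<oplus>\<^bsub>H\<^esub> finsum H (\<lambda>i. S' i (z i)) F" for z
  have KX: "complex_of_real a \<in> K" for a
    by (rule H.of_real_K)
  have cns: "cmod (complex_of_real (n i / s)) = n i / s" if "i \<in> F" for i
    using npos[OF that] s by (simp only: norm_of_real) simp
  have uF: "u i = complex_of_real (n i / s) \<odot>\<^bsub>X i\<^esub> v i" if "i \<in> F" for i
    using that F by (auto simp: u_def)
  have uc: "u \<in> carrier L"
  proof -
    have "(\<lambda>i. vnorm (X i) (u i)) summable_on I \<longleftrightarrow> (\<lambda>i. vnorm (X i) (u i)) summable_on F"
      by (rule summable_on_cong_neutral) (use F in \<open>auto simp: u_def\<close>)
    moreover have "u \<in> (\<Pi>\<^sub>E i\<in>I. carrier (X i))"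
      using vc KX by (auto simp: u_def simp del: of_real_divide)
    ultimately show ?thesis
      using F by (simp add: l1_sum_simps)
  qed
  have cut_u: "l1_cut I X F u = \<zero>\<^bsub>L\<^esub>"
    unfolding l1_cut_def u_def l1_sum_simps by (rule restrict_ext) simp
  have "(\<Sum>i\<in>F. vnorm (X i) (u i)) = (\<Sum>i\<in>F. n i / s)"
    using F vc KX cns by (intro sum.cong) (auto simp: uF subset_iff simp del: of_real_divide)
  also have "\<dots> = 1"
    using s by (simp add: sum_divide_distrib[symmetric] s_def[symmetric])
  finally have u1: "vnorm L u = 1"
    using norm_l1_cut[OF uc F(1,2)] by (simp add: cut_u)
  have us: "u \<in> unit_sphere L"
    using uc u1 by (simp add: unit_sphere_def)

  have Sc: "S \<in> contractions K L H"
    unfolding S_def by (rule contractions_glue[OF Tc F(1,2) S'c])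
  \<comment> \<open>Every \<open>S' i (v i)\<close> is \<open>h\<close>, so the value is a convex
    combination of copies of \<open>h\<close>.\<close>
  have Su: "S u = h"
  proof -
    have "finsum H (\<lambda>i. S' i (u i)) F = finsum H (\<lambda>i. complex_of_real (n i / s) \<odot>\<^bsub>H\<^esub> h) F"
      using h KX vc contractionsD(4)[OF S'c]
      by (intro H.finsum_cong') (auto simp: uF S'v simp del: of_real_divide)
    also have "\<dots> = (\<Sum>i\<in>F. complex_of_real (n i / s)) \<odot>\<^bsub>H\<^esub> h"
      using H.finsum_smult_left[OF F(1), of "\<lambda>i. complex_of_real (n i / s)" h] h KX by blast
    also have "(\<Sum>i\<in>F. complex_of_real (n i / s)) = 1"
    proof -
      have "(\<Sum>i\<in>F. n i / s) = 1"
        using s by (simp add: sum_divide_distrib[symmetric] s_def[symmetric])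
      then show ?thesis
        by (metis of_real_1 of_real_sum)
    qed
    finally show ?thesis
      using h LH.bounded_operators_zero[OF Tb] by (simp add: S_def cut_u)
  qed

  have ux: "vnorm L (u \<ominus>\<^bsub>L\<^esub> x) < 5 * e"
  proof -
    \<comment> \<open>First the weight moves from \<open>n i / s\<close> to \<open>n i\<close>, then
      the vector from \<open>v i\<close> to \<open>y i\<close>.\<close>
    have coord_le: "vnorm (X i) ((u \<ominus>\<^bsub>L\<^esub> x) i) \<le> n i / s - n i + e * n i" if i: "i \<in> F" for i
    proof -
      have iI: "i \<in> I" using i F by auto
      interpret nspace K "X i" by (rule summand[OF iI])
      let ?a = "complex_of_real (n i / s)" and ?b = "complex_of_real (n i)"
      have "vnorm (X i) ((u \<ominus>\<^bsub>L\<^esub> x) i) = vnorm (X i) (?a \<odot>\<^bsub>X i\<^esub> v i \<ominus>\<^bsub>X i\<^esub> ?b \<odot>\<^bsub>X i\<^esub> y i)"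
        using l1_minus_apply[OF uc xc iI] uF[OF i] x_eq[OF i] by simp
      also have "\<dots> \<le> vnorm (X i) (?a \<odot>\<^bsub>X i\<^esub> v i \<ominus>\<^bsub>X i\<^esub> ?b \<odot>\<^bsub>X i\<^esub> v i)
          + vnorm (X i) (?b \<odot>\<^bsub>X i\<^esub> v i \<ominus>\<^bsub>X i\<^esub> ?b \<odot>\<^bsub>X i\<^esub> y i)"
        using KX vc[OF i] yc[OF i] by (intro dist_triangle smult_closed') (auto simp del: of_real_divide)
      also have "?a \<odot>\<^bsub>X i\<^esub> v i \<ominus>\<^bsub>X i\<^esub> ?b \<odot>\<^bsub>X i\<^esub> v i = complex_of_real (n i / s - n i) \<odot>\<^bsub>X i\<^esub> v i"
        using smult_diff[OF KX KX vc(1)[OF i], of "n i / s" "n i"] by simp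
      also have "vnorm (X i) \<dots> = \<bar>n i / s - n i\<bar>"
        using norm_smult[OF KX vc(1)[OF i], of "n i / s - n i"] vc(2)[OF i] by (simp only: norm_of_real mult_1_right)
      also have "\<bar>n i / s - n i\<bar> = n i / s - n i"
        using npos[OF i] s by (simp add: pos_le_divide_eq mult_left_le)
      also have "?b \<odot>\<^bsub>X i\<^esub> v i \<ominus>\<^bsub>X i\<^esub> ?b \<odot>\<^bsub>X i\<^esub> y i = ?b \<odot>\<^bsub>X i\<^esub> (v i \<ominus>\<^bsub>X i\<^esub> y i)"
        using smult_minus_distr[OF KX vc(1)[OF i] yc(1)[OF i]] by simp
      also have "vnorm (X i) \<dots> = n i * vnorm (X i) (v i \<ominus>\<^bsub>X i\<^esub> y i)"
        using KX vc[OF i] yc[OF i] npos[OF i] by simp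
      also have "\<dots> \<le> e * n i"
        using vy[OF i] npos[OF i] by (simp add: mult.commute)
      finally show ?thesis by simp
    qed
    note uxc = L.minus_closed[OF uc xc]
    note cutb = contractionsD(1)[OF l1_cut[OF F(1,2)]]
    have "l1_cut I X F (u \<ominus>\<^bsub>L\<^esub> x) = \<zero>\<^bsub>L\<^esub> \<ominus>\<^bsub>L\<^esub> l1_cut I X F x"
      using LL.bounded_operators_minus[OF cutb uc xc] by (simp add: cut_u)
    then have "vnorm L (l1_cut I X F (u \<ominus>\<^bsub>L\<^esub> x)) = vnorm L (l1_cut I X F x)"
      using l1_cut_closed[OF xc, of F] by (simp add: L.minus_smult)
    also have "\<dots> = 1 - s"
      using norm_l1_cut[OF xc F(1,2)] x1 by (simp add: n_def s_def)
    finally have "vnorm L (u \<ominus>\<^bsub>L\<^esub> x) = (1 - s) + (\<Sum>i\<in>F. vnorm (X i) ((u \<ominus>\<^bsub>L\<^esub> x) i))"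
      using norm_l1_cut[OF uxc F(1,2)] by simp
    also have "\<dots> \<le> (1 - s) + (\<Sum>i\<in>F. n i / s - n i + e * n i)"
      using coord_le by (intro add_left_mono sum_mono) auto
    also have "(\<Sum>i\<in>F. n i / s - n i + e * n i) = 1 - s + e * s"
      using s by (simp add: sum.distrib sum_subtractf sum_divide_distrib[symmetric]
          sum_distrib_left[symmetric] s_def[symmetric])
    \<comment> \<open>The mass outside \<open>F\<close> and the rescaling of the weights cost
      \<open>1 - s < 2 * e\<close> each, the change of vectors at most \<open>e\<close>.\<close>
    also have "(1 - s) + (1 - s + e * s) < 5 * e"
      using s e mult_left_le[of s e] by linarith
    finally show ?thesis .
  qed

  have ST: "vnorm H (S z \<ominus>\<^bsub>H\<^esub> T z) \<le> 10 * e * vnorm L z" if z: "z \<in> carrier L" for z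
  proof -
    have zc: "z i \<in> carrier (X i)" if "i \<in> F" for i
      using coord[OF z] that F by auto
    let ?A = "finsum H (\<lambda>i. S' i (z i)) F" and ?B = "finsum H (\<lambda>i. Ti i (z i)) F"
    let ?c = "T (l1_cut I X F z)"
    have f: "(\<lambda>i. S' i (z i)) \<in> F \<rightarrow> carrier H" "(\<lambda>i. Ti i (z i)) \<in> F \<rightarrow> carrier H"
      using contractionsD(2)[OF S'c zc] contractionsD(2)[OF Tic zc] F by auto
    note AB = H.finsum_closed[OF f(1)] H.finsum_closed[OF f(2)]
    have c: "?c \<in> carrier H"
      using contractionsD(2)[OF Tc l1_cut_closed[OF z]] .
    have "T z = ?c \<oplus>\<^bsub>H\<^esub> ?B"
      unfolding Ti_def by (rule operator_split[OF Tb z F(1,2)])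
    \<comment> \<open>The tail term is common to both operators and cancels.\<close>
    then have "S z \<ominus>\<^bsub>H\<^esub> T z = ?A \<ominus>\<^bsub>H\<^esub> ?B"
      using c AB by (simp add: S_def H.add_minus_add)
    also have "\<dots> = finsum H (\<lambda>i. S' i (z i) \<ominus>\<^bsub>H\<^esub> Ti i (z i)) F"
      by (rule H.finsum_minus_distrib[OF F(1) f])
    also have "vnorm H \<dots> \<le> (\<Sum>i\<in>F. vnorm H (S' i (z i) \<ominus>\<^bsub>H\<^esub> Ti i (z i)))"
      using f by (intro H.norm_finsum F(1)) auto
    also have "\<dots> \<le> (\<Sum>i\<in>F. 10 * e * vnorm (X i) (z i))"
      by (intro sum_mono S'T zc)
    also have "\<dots> = 10 * e * (\<Sum>i\<in>F. vnorm (X i) (z i))"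
      by (simp add: sum_distrib_left)
    also have "\<dots> \<le> 10 * e * vnorm L z"
      using norm_l1_cut[OF z F(1,2)] L.norm_nonneg[OF l1_cut_closed[OF z, of F]] e
      by (intro mult_left_mono) auto
    finally show ?thesis .
  qed
  have "op_norm L H (\<lambda>z. S z \<ominus>\<^bsub>H\<^esub> T z) \<le> 10 * e"
  proof (rule LH.op_norm_least)
    fix z assume z: "z \<in> carrier L" "vnorm L z \<le> 1"
    have "10 * e * vnorm L z \<le> 10 * e"
      using z e by (simp add: mult_left_le)
    then show "vnorm H (S z \<ominus>\<^bsub>H\<^esub> T z) \<le> 10 * e"
      using ST[OF z(1)] by linarith
  qed
  moreover have "vnorm H (S u) = 1"
    using Su h by simp
  ultimately show thesis
    using that us LH.contractions_op_sphere[OF Sc us] ux by blast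
qed

theorem proposition2p3:
  fixes K :: "complex set"
    and I :: "'i set"
    and X :: "'i \<Rightarrow> 'a nspace"
    and H :: "'h nspace"
  assumes "K = \<real> \<or> K = UNIV"
    and "\<And>i. i \<in> I \<Longrightarrow> banach_space K (X i)"
    and "hilbert_space K H"
    and "\<exists>\<eta>. \<forall>i\<in>I. BPBp_with \<eta> K (X i) H"
  shows "BPBp K (l1_sum I X) H"
proof (cases "I = {}")
  case True
  then show ?thesis
    \<comment> \<open>The norm is an empty sum, so the unit sphere is empty and any positive
      function serves. The case is separate because positivity of \<open>\<eta>\<close> is read off
      from a summand.\<close>
    unfolding BPBp_def BPBp_with_def by (intro exI[of _ "\<lambda>_. 1"]) (simp add: unit_sphere_def)
next
  case False
  obtain ip where ip: "inner_product_on K H ip" "\<forall>x\<in>carrier H. vnorm H x = sqrt (Re (ip x x))"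
    using assms(3) unfolding hilbert_space_def by blast
  have H: "normed_space K H"
    using assms(3) unfolding hilbert_space_def banach_space_def by blast
  have R: "\<real> \<subseteq> K"
    using assms(1) by auto
  have cring: "cring (scalars K)"
    using H unfolding normed_space_def by (blast intro: module.axioms(1))
  interpret l1_family_hilbert K I X H ip
  proof (intro l1_family_hilbert.intro l1_family.intro inner_product_space.intro
      inner_product_space_axioms.intro nspace.intro)
    show "normed_space K (X i)" if "i \<in> I" for i
      using assms(2)[OF that] unfolding banach_space_def by blast
  qed (use H R cring ip in blast)+
  obtain \<eta> where \<eta>: "\<And>i. i \<in> I \<Longrightarrow> BPBp_with \<eta> K (X i) H"
    using assms(4) by blast
  have \<eta>pos: "\<eta> e > 0" if "e > 0" for e
    using \<eta> False that unfolding BPBp_with_def by blast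
  \<comment> \<open>The factor 20 leaves room for the errors 5 e and 10 e; the cap is the bound on
    \<open>e\<close> in \<open>BPBp_with_l1_sum\<close>.\<close>
  define e where "e \<epsilon> = min (\<epsilon> / 20) (1 / 20)" for \<epsilon> :: real
  \<comment> \<open>The largest value meeting all upper bounds on \<open>d\<close>; it depends on
    \<open>\<epsilon>\<close> and the common \<open>\<eta>\<close> alone.\<close>
  define d where "d \<epsilon> = min (min (\<eta> (e \<epsilon>)) (e \<epsilon>)) (min ((e \<epsilon>)\<^sup>2 / 2) (1 / 2))" for \<epsilon> :: real
  have "BPBp_with (\<lambda>\<epsilon>. d \<epsilon> * e \<epsilon> / 2) K L H"
    unfolding BPBp_with_def
  proof (intro allI impI conjI ballI)
    fix \<epsilon> :: real assume \<epsilon>: "\<epsilon> > 0"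
    then have e: "0 < e \<epsilon>" "e \<epsilon> \<le> 1 / 20" "20 * e \<epsilon> \<le> \<epsilon>"
      by (auto simp: e_def)
    have d: "0 < d \<epsilon>" "d \<epsilon> \<le> \<eta> (e \<epsilon>)" "d \<epsilon> \<le> e \<epsilon>" "d \<epsilon> \<le> (e \<epsilon>)\<^sup>2 / 2" "d \<epsilon> \<le> 1 / 2"
      using e \<eta>pos[OF e(1)] by (auto simp: d_def)
    show "0 < d \<epsilon> * e \<epsilon> / 2"
      using e d by simp
    fix T x assume T: "T \<in> op_sphere K L H" and x: "x \<in> unit_sphere L"
      and Tx: "1 - d \<epsilon> * e \<epsilon> / 2 < vnorm H (T x)"
    obtain u S where "u \<in> unit_sphere L" "S \<in> op_sphere K L H" "vnorm H (S u) = 1"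
      "vnorm L (u \<ominus>\<^bsub>L\<^esub> x) < 5 * e \<epsilon>" "op_norm L H (\<lambda>z. S z \<ominus>\<^bsub>H\<^esub> T z) \<le> 10 * e \<epsilon>"
      using BPBp_with_l1_sum[OF \<eta> T x e(1,2) d Tx] by blast
    moreover have "5 * e \<epsilon> < \<epsilon>" "10 * e \<epsilon> < \<epsilon>"
      using e by linarith+
    ultimately show "\<exists>u\<in>unit_sphere L. \<exists>S\<in>op_sphere K L H. vnorm H (S u) = 1 \<and>
        vnorm L (u \<ominus>\<^bsub>L\<^esub> x) < \<epsilon> \<and> op_norm L H (\<lambda>z. S z \<ominus>\<^bsub>H\<^esub> T z) < \<epsilon>"
      by (meson less_trans le_less_trans)
  qed
  then show ?thesis
    unfolding BPBp_def by blast
qed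

end
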